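(* Let $m,n,a,b,c\in\mathbb Z_{\ge0}$ with $m\ge c$, $n-b+c\ge0$, and put $\beta:=n-m+a-2b+3c+\varsigma_1$. Assume $\beta>0$, $\beta$ is even, and $b>a+c$. Then in $L(m,n)$ $$B^{(a)}_{1}B^{(b)}_{2}B^{(c)}_{1}\eta=[\beta]\sum_{\substack{0\le k\le a\\ k\ \mathrm{even}}}\frac{[\beta-k+2][\beta-k+4]\cdots[\beta+k-2]}{[k]!}\mathfrak{B}^{(a-k,b-k,c)}_{2}+\sum_{\substack{0\le k\le a\\ k\ \mathrm{odd}}}\frac{[\beta-k+1][\beta-k+3]\cdots[\beta+k-1]}{[k]!}\mathfrak{B}^{(a-k,b-k,c)}_{2}$$ and $$\mathfrak{B}_{2}^{(a,b,c)}=\sum_{k=0}^{a}(-1)^{k}\frac{[\beta][\beta+2]\cdots[\beta+2k-2]}{[k]!}B_{1}^{(a-k)}B^{(b-k)}_{2}B^{(c)}_{1}\eta.$$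
   Context: Conventions: products written with dots run in steps of $2$ ($[\beta-k+2]\cdots[\beta+k-2]$ has $k-1$ factors), and the full coefficient of each $k=0$ term (including the prefactor $[\beta]$) is $1$. For $r\in\mathbb Z$: $[r]=\frac{q^r-q^{-r}}{q-q^{-1}}$; $[r]!=[1]\cdots[r]$, $[0]!=1$; $X^{(r)}=X^r/[r]!$ for $r\ge0$ and $X^{(r)}=0$ for $r<0$. $\mathbf U=U_q(\mathfrak{sl}_3)$ is the $\mathbb Q(q)$-algebra generated by $E_i,F_i,K_i^{\pm1}$, $i\in\{1,2\}$, with $K_1K_2=K_2K_1$, $K_iE_jK_i^{-1}=q^{a_{ij}}E_j$, $K_iF_jK_i^{-1}=q^{-a_{ij}}F_j$ ($a_{ii}=2$, $a_{12}=a_{21}=-1$), $E_iF_j-F_jE_i=\delta_{ij}\frac{K_i-K_i^{-1}}{q-q^{-1}}$, and for $i\ne j$ the Serre relations $E_jE_i^{(2)}-E_iE_jE_i+E_i^{(2)}E_j=0$, $F_jF_i^{(2)}-F_iF_jF_i+F_i^{(2)}F_j=0$. $\tau$ swaps $1$ and $2$. The parameter is $\varsigma=(\varsigma_1,\varsigma_2)\in\{(1,0),(0,1)\}$. $\mathbf U^\imath$ is the subalgebra of $\mathbf U$ generated by $B_i=F_i+q^{\varsigma_i}E_{\tau i}K_i^{-1}$, $k_i=K_iK_{\tau i}^{-1}$. $\psi^\imath$ is the $\mathbb Q$-algebra automorphism of $\mathbf U^\imath$ with $q\mapsto q^{-1}$, $B_i\mapsto B_i$, $k_i\mapsto k_i^{-1}$.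 $L(m,n)$ is the simple $\mathbf U$-module of highest weight $m\omega_1+n\omega_2$ with highest weight vector $\eta$; $\psi^\imath$ also denotes the anti-linear involution of $L(m,n)=\mathbf U^\imath\eta$ with $\psi^\imath(u\eta)=\psi^\imath(u)\eta$. iCanonical basis: for $a,b,c\ge0$, $b\ge a+c$ with $F_1^{(a)}F_2^{(b)}F_1^{(c)}\eta\neq0$ (equivalently $c\le m$, $b-c\le n$), $\mathfrak B_2^{(a,b,c)}\in L(m,n)$ is the unique $\psi^\imath$-invariant element of $F_1^{(a)}F_2^{(b)}F_1^{(c)}\eta+\sum_{x,y\ge0,(x,y)\ne(0,0)}q^{-1}\mathbb Z[q^{-1}]F_1^{(a-x)}F_2^{(b-x-y)}F_1^{(c-y)}\eta$. *)

theory Defs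
  imports "HOL-Computational_Algebra.Computational_Algebra"
begin

section \<open>The field of rational functions in q\<close>

type_synonym Qq = "rat poly fract"

definition qconst :: "rat \<Rightarrow> Qq" where
  "qconst r = to_fract [:r:]"

definition q :: Qq where
  "q = to_fract [:0, 1:]"

text \<open>Substitution of the inverse of q into a polynomial, and the resulting involution of the
  field, which is the automorphism over the rationals sending q to its inverse.\<close>

definition eval_qinv :: "rat poly \<Rightarrow> Qq" where
  "eval_qinv p = poly (map_poly qconst p) (inverse q)"

definition bar :: "Qq \<Rightarrow> Qq" where
  "bar f = (THE g. \<exists>a b. b \<noteq> 0 \<and> f = Fract a b \<and> g = eval_qinv a / eval_qinv b)"

lemma qconst_0 [simp]: "qconst 0 = 0"
  and qconst_1 [simp]: "qconst 1 = 1"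
  and qconst_add: "qconst (r + s) = qconst r + qconst s"
  and qconst_mult: "qconst (r * s) = qconst r * qconst s"
  and qconst_eq_0_iff [simp]: "qconst r = 0 \<longleftrightarrow> r = 0"
  by (simp_all add: qconst_def flip: to_fract_add to_fract_mult one_pCons)

lemma q_nonzero [simp]: "q \<noteq> 0"
  by (simp add: q_def)

lemma poly_qconst_q: "poly (map_poly qconst p) q = to_fract p"
  by (induction p) (simp_all add: map_poly_pCons q_def qconst_def flip: to_fract_add to_fract_mult)

lemma map_poly_qconst_add: "map_poly qconst (p + r) = map_poly qconst p + map_poly qconst r"
  by (rule poly_eqI) (simp add: coeff_map_poly qconst_add)

lemma map_poly_qconst_mult: "map_poly qconst (p * r) = map_poly qconst p * map_poly qconst r"
proof (induction p)
  case (pCons a p)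
  have "map_poly qconst (smult a r) = smult (qconst a) (map_poly qconst r)"
    by (rule poly_eqI) (simp add: coeff_map_poly qconst_mult)
  then show ?case using pCons
    by (simp add: map_poly_pCons map_poly_qconst_add)
qed simp

lemma eval_qinv_add: "eval_qinv (p + r) = eval_qinv p + eval_qinv r"
  and eval_qinv_mult: "eval_qinv (p * r) = eval_qinv p * eval_qinv r"
  by (simp_all add: eval_qinv_def map_poly_qconst_add map_poly_qconst_mult)

lemma eval_qinv_eq_0_iff [simp]: "eval_qinv p = 0 \<longleftrightarrow> p = 0"
proof
  assume *: "eval_qinv p = 0"
  have deg: "degree (map_poly qconst p) = degree p"
    by (rule degree_map_poly) simp
  have "reflect_poly (map_poly qconst p) = map_poly qconst (reflect_poly p)"
    by (rule poly_eqI) (simp add: coeff_reflect_poly coeff_map_poly deg)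
  then have "to_fract (reflect_poly p) = poly (reflect_poly (map_poly qconst p)) q"
    by (simp add: poly_qconst_q)
  also have "\<dots> = q ^ degree (map_poly qconst p) * eval_qinv p"
    by (simp add: poly_reflect_poly_nz eval_qinv_def)
  finally show "p = 0" using * by simp
qed (simp add: eval_qinv_def)

lemma bar_Fract:
  assumes "b \<noteq> 0"
  shows "bar (Fract a b) = eval_qinv a / eval_qinv b"
  unfolding bar_def
proof (rule the_equality)
  show "\<exists>a' b'. b' \<noteq> 0 \<and> Fract a b = Fract a' b' \<and>
          eval_qinv a / eval_qinv b = eval_qinv a' / eval_qinv b'"
    using assms by blast
next
  fix g assume "\<exists>c d. d \<noteq> 0 \<and> Fract a b = Fract c d \<and> g = eval_qinv c / eval_qinv d"
  then obtain c d where d: "d \<noteq> 0" and eq: "Fract a b = Fract c d"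
    and g: "g = eval_qinv c / eval_qinv d" by blast
  from eq have "a * d = c * b" using assms d by (simp add: eq_fract)
  then have "eval_qinv a * eval_qinv d = eval_qinv c * eval_qinv b"
    by (simp flip: eval_qinv_mult)
  then show "g = eval_qinv a / eval_qinv b" using assms d by (simp add: g frac_eq_eq)
qed

lemma bar_add: "bar (f + g) = bar f + bar g"
  and bar_mult: "bar (f * g) = bar f * bar g"
  by (cases f; cases g;
      simp add: bar_Fract eval_qinv_add eval_qinv_mult add_frac_eq mult.commute)+

lemma bar_to_fract: "bar (to_fract p) = eval_qinv p"
  using bar_Fract[of 1 p] by (simp add: to_fract_def eval_qinv_def)

lemma bar_qconst: "bar (qconst r) = qconst r"
  using bar_to_fract[of "[:r:]"] by (simp add: qconst_def[of r] eval_qinv_def map_poly_pCons)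

lemma bar_q: "bar q = inverse q"
  using bar_to_fract[of "[:0, 1:]"] by (simp add: q_def[symmetric] eval_qinv_def map_poly_pCons)

definition qint :: "int \<Rightarrow> Qq" where
  "qint r = (q powi r - q powi (- r)) / (q - inverse q)"

definition qfact :: "nat \<Rightarrow> Qq" where
  "qfact r = (\<Prod>i = 1..r. qint (int i))"

text \<open>The product of \<open>l\<close> quantum integers
  whose arguments start at \<open>r\<close> and increase in steps of 2.\<close>

definition qprod :: "int \<Rightarrow> nat \<Rightarrow> Qq" where
  "qprod r l = (\<Prod>j<l. qint (r + 2 * int j))"

definition qinv_int_polys :: "Qq set" where
  "qinv_int_polys = {inverse q * poly (map_poly of_int p) (inverse q) | p :: int poly. True}"

section \<open>The quantum group of type A2\<close>

datatype idx = I1 | I2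

fun tau :: "idx \<Rightarrow> idx" where
  "tau I1 = I2"
| "tau I2 = I1"

definition cartan :: "idx \<Rightarrow> idx \<Rightarrow> int" where
  "cartan i j = (if i = j then 2 else - 1)"

text \<open>The algebra is constructed from its presentation, as the set of formal algebra expressions
  in the generators modulo the least congruence that contains the laws of unital associative
  algebras over the field and the defining relations.  \<open>Scal c\<close> stands for c times the unit.\<close>

datatype uexp =
    Scal Qq
  | Egen idx | Fgen idx | Kgen idx | Kinvgen idx
  | Add uexp uexp
  | Mul uexp uexp

definition divsq :: "uexp \<Rightarrow> uexp" where
  "divsq x = Mul (Scal (inverse (qint 2))) (Mul x x)"

definition Sub :: "uexp \<Rightarrow> uexp \<Rightarrow> uexp" where
  "Sub x y = Add x (Mul (Scal (- 1)) y)"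

inductive urel :: "uexp \<Rightarrow> uexp \<Rightarrow> bool" where
  refl: "urel x x"
| sym: "urel x y \<Longrightarrow> urel y x"
| trans: "urel x y \<Longrightarrow> urel y z \<Longrightarrow> urel x z"
| add_cong: "urel x x' \<Longrightarrow> urel y y' \<Longrightarrow> urel (Add x y) (Add x' y')"
| mul_cong: "urel x x' \<Longrightarrow> urel y y' \<Longrightarrow> urel (Mul x y) (Mul x' y')"
| add_assoc: "urel (Add (Add x y) z) (Add x (Add y z))"
| add_comm: "urel (Add x y) (Add y x)"
| add_zero: "urel (Add (Scal 0) x) x"
| add_neg: "urel (Add (Mul (Scal (- 1)) x) x) (Scal 0)"
| mul_assoc: "urel (Mul (Mul x y) z) (Mul x (Mul y z))"
| one_left: "urel (Mul (Scal 1) x) x"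
| one_right: "urel (Mul x (Scal 1)) x"
| distrib_right: "urel (Mul (Add x y) z) (Add (Mul x z) (Mul y z))"
| distrib_left: "urel (Mul x (Add y z)) (Add (Mul x y) (Mul x z))"
| scal_add: "urel (Scal (c + d)) (Add (Scal c) (Scal d))"
| scal_mul: "urel (Scal (c * d)) (Mul (Scal c) (Scal d))"
| scal_central: "urel (Mul (Scal c) x) (Mul x (Scal c))"
| K_Kinv: "urel (Mul (Kgen i) (Kinvgen i)) (Scal 1)"
| Kinv_K: "urel (Mul (Kinvgen i) (Kgen i)) (Scal 1)"
| K_comm: "urel (Mul (Kgen I1) (Kgen I2)) (Mul (Kgen I2) (Kgen I1))"
| K_E: "urel (Mul (Mul (Kgen i) (Egen j)) (Kinvgen i))
             (Mul (Scal (q powi cartan i j)) (Egen j))"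
| K_F: "urel (Mul (Mul (Kgen i) (Fgen j)) (Kinvgen i))
             (Mul (Scal (q powi (- cartan i j))) (Fgen j))"
| E_F_same: "urel (Sub (Mul (Egen i) (Fgen i)) (Mul (Fgen i) (Egen i)))
                  (Mul (Scal (inverse (q - inverse q))) (Sub (Kgen i) (Kinvgen i)))"
| E_F_diff: "i \<noteq> j \<Longrightarrow> urel (Sub (Mul (Egen i) (Fgen j)) (Mul (Fgen j) (Egen i))) (Scal 0)"
| serre_E: "i \<noteq> j \<Longrightarrow>
    urel (Add (Sub (Mul (Egen j) (divsq (Egen i))) (Mul (Mul (Egen i) (Egen j)) (Egen i)))
              (Mul (divsq (Egen i)) (Egen j))) (Scal 0)"
| serre_F: "i \<noteq> j \<Longrightarrow>
    urel (Add (Sub (Mul (Fgen j) (divsq (Fgen i))) (Mul (Mul (Fgen i) (Fgen j)) (Fgen i)))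
              (Mul (divsq (Fgen i)) (Fgen j))) (Scal 0)"

lemma equivp_urel: "equivp urel"
  by (rule equivpI) (auto intro!: reflpI sympI transpI intro: urel.refl urel.sym urel.trans)

text \<open>The counit, used only to see that the quotient is not the zero ring.\<close>

primrec counit :: "uexp \<Rightarrow> Qq" where
  "counit (Scal c) = c"
| "counit (Egen i) = 0"
| "counit (Fgen i) = 0"
| "counit (Kgen i) = 1"
| "counit (Kinvgen i) = 1"
| "counit (Add x y) = counit x + counit y"
| "counit (Mul x y) = counit x * counit y"

lemma counit_urel: "urel x y \<Longrightarrow> counit x = counit y"
  by (induction rule: urel.induct) (simp_all add: algebra_simps Sub_def divsq_def)

quotient_type Uq = uexp / urel
  by (rule equivp_urel)

instantiation Uq :: ring_1
begin

lift_definition zero_Uq :: Uq is "Scal 0" .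
lift_definition one_Uq :: Uq is "Scal 1" .
lift_definition plus_Uq :: "Uq \<Rightarrow> Uq \<Rightarrow> Uq" is Add by (rule urel.add_cong)
lift_definition times_Uq :: "Uq \<Rightarrow> Uq \<Rightarrow> Uq" is Mul by (rule urel.mul_cong)
lift_definition uminus_Uq :: "Uq \<Rightarrow> Uq" is "Mul (Scal (- 1))"
  by (intro urel.mul_cong urel.refl)
lift_definition minus_Uq :: "Uq \<Rightarrow> Uq \<Rightarrow> Uq" is Sub
  unfolding Sub_def by (intro urel.add_cong urel.mul_cong urel.refl)

instance
proof
  show "(0 :: Uq) \<noteq> 1" by transfer (auto dest: counit_urel)
qed (transfer, auto simp: Sub_def intro: urel.intros)+

end

lift_definition scal :: "Qq \<Rightarrow> Uq" is Scal .
lift_definition E :: "idx \<Rightarrow> Uq" is Egen .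
lift_definition F :: "idx \<Rightarrow> Uq" is Fgen .
lift_definition K :: "idx \<Rightarrow> Uq" is Kgen .
lift_definition Kinv :: "idx \<Rightarrow> Uq" is Kinvgen .

text \<open>Divided powers, zero for negative exponents.\<close>

definition dpow :: "Uq \<Rightarrow> int \<Rightarrow> Uq" where
  "dpow x r = (if r < 0 then 0 else scal (inverse (qfact (nat r))) * x ^ nat r)"

section \<open>The coideal subalgebra and its bar involution\<close>

definition B :: "(idx \<Rightarrow> int) \<Rightarrow> idx \<Rightarrow> Uq" where
  "B \<sigma> i = F i + scal (q powi \<sigma> i) * E (tau i) * Kinv i"

definition kk :: "idx \<Rightarrow> Uq" where
  "kk i = K i * Kinv (tau i)"

definition kkinv :: "idx \<Rightarrow> Uq" where
  "kkinv i = K (tau i) * Kinv i"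

lemma K_Kinv: "K i * Kinv i = 1"
  by transfer (rule urel.K_Kinv)

lemma Kinv_K: "Kinv i * K i = 1"
  by transfer (rule urel.Kinv_K)

lemma kk_kkinv: "kk i * kkinv i = 1"
  by (metis K_Kinv Kinv_K kk_def kkinv_def mult.assoc mult.left_neutral)

lemma kkinv_kk: "kkinv i * kk i = 1"
  by (metis K_Kinv Kinv_K kk_def kkinv_def mult.assoc mult.left_neutral)

inductive_set Ui :: "(idx \<Rightarrow> int) \<Rightarrow> Uq set" for \<sigma> :: "idx \<Rightarrow> int" where
  scal: "scal c \<in> Ui \<sigma>"
| B: "B \<sigma> i \<in> Ui \<sigma>"
| kk: "kk i \<in> Ui \<sigma>"
| add: "x \<in> Ui \<sigma> \<Longrightarrow> y \<in> Ui \<sigma> \<Longrightarrow> x + y \<in> Ui \<sigma>"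
| mult: "x \<in> Ui \<sigma> \<Longrightarrow> y \<in> Ui \<sigma> \<Longrightarrow> x * y \<in> Ui \<sigma>"

text \<open>\<open>psi\<close> restricts to the bar involution of the coideal subalgebra; its values outside are
  irrelevant.\<close>

definition is_ibar :: "(idx \<Rightarrow> int) \<Rightarrow> (Uq \<Rightarrow> Uq) \<Rightarrow> bool" where
  "is_ibar \<sigma> psi \<longleftrightarrow>
     bij_betw psi (Ui \<sigma>) (Ui \<sigma>) \<and>
     (\<forall>x\<in>Ui \<sigma>. \<forall>y\<in>Ui \<sigma>. psi (x + y) = psi x + psi y) \<and>
     (\<forall>x\<in>Ui \<sigma>. \<forall>y\<in>Ui \<sigma>. psi (x * y) = psi x * psi y) \<and>
     (\<forall>c. psi (scal c) = scal (bar c)) \<and>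
     (\<forall>i. psi (B \<sigma> i) = B \<sigma> i) \<and>
     (\<forall>i. psi (kk i) = kkinv i)"

section \<open>Simple highest weight modules\<close>

text \<open>The field acts on a module through \<open>scal\<close>.\<close>

definition is_module :: "(Uq \<Rightarrow> 'v \<Rightarrow> 'v::ab_group_add) \<Rightarrow> bool" where
  "is_module act \<longleftrightarrow>
     (\<forall>u v w. act u (v + w) = act u v + act u w) \<and>
     (\<forall>u u' v. act (u + u') v = act u v + act u' v) \<and>
     (\<forall>u u' v. act (u * u') v = act u (act u' v)) \<and>
     (\<forall>v. act 1 v = v)"

definition is_submodule :: "(Uq \<Rightarrow> 'v \<Rightarrow> 'v::ab_group_add) \<Rightarrow> 'v set \<Rightarrow> bool" where
  "is_submodule act N \<longleftrightarrow>
     0 \<in> N \<and> (\<forall>v\<in>N. \<forall>w\<in>N. v + w \<in> N) \<and> (\<forall>u. \<forall>v\<in>N. act u v \<in> N)"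

definition is_simple_module :: "(Uq \<Rightarrow> 'v \<Rightarrow> 'v::ab_group_add) \<Rightarrow> bool" where
  "is_simple_module act \<longleftrightarrow>
     is_module act \<and> (UNIV :: 'v set) \<noteq> {0} \<and>
     (\<forall>N. is_submodule act N \<longrightarrow> N = {0} \<or> N = UNIV)"

definition is_highest_weight_vector ::
    "(Uq \<Rightarrow> 'v \<Rightarrow> 'v::ab_group_add) \<Rightarrow> nat \<Rightarrow> nat \<Rightarrow> 'v \<Rightarrow> bool" where
  "is_highest_weight_vector act m n \<eta> \<longleftrightarrow>
     \<eta> \<noteq> 0 \<and> (\<forall>i. act (E i) \<eta> = 0) \<and>
     act (K I1) \<eta> = act (scal (q ^ m)) \<eta> \<and> act (K I2) \<eta> = act (scal (q ^ n)) \<eta>"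

text \<open>The whole type \<open>'v\<close> is the simple module of highest weight \<open>m\<omega>\<^sub>1 + n\<omega>\<^sub>2\<close>,
  with highest weight vector \<open>\<eta>\<close>.\<close>

definition is_L :: "(Uq \<Rightarrow> 'v \<Rightarrow> 'v::ab_group_add) \<Rightarrow> nat \<Rightarrow> nat \<Rightarrow> 'v \<Rightarrow> bool" where
  "is_L act m n \<eta> \<longleftrightarrow> is_simple_module act \<and> is_highest_weight_vector act m n \<eta>"

definition is_ibar_module ::
    "(idx \<Rightarrow> int) \<Rightarrow> (Uq \<Rightarrow> Uq) \<Rightarrow> (Uq \<Rightarrow> 'v \<Rightarrow> 'v::ab_group_add) \<Rightarrow> 'v \<Rightarrow> ('v \<Rightarrow> 'v) \<Rightarrow> bool" where
  "is_ibar_module \<sigma> psi act \<eta> psiL \<longleftrightarrow>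
     (\<forall>v w. psiL (v + w) = psiL v + psiL w) \<and>
     (\<forall>c v. psiL (act (scal c) v) = act (scal (bar c)) (psiL v)) \<and>
     (\<forall>v. psiL (psiL v) = v) \<and>
     (\<forall>u\<in>Ui \<sigma>. psiL (act u \<eta>) = act (psi u) \<eta>)"

section \<open>The icanonical basis\<close>

definition Fmon :: "(Uq \<Rightarrow> 'v \<Rightarrow> 'v::ab_group_add) \<Rightarrow> 'v \<Rightarrow> int \<Rightarrow> int \<Rightarrow> int \<Rightarrow> 'v" where
  "Fmon act \<eta> a b c = act (dpow (F I1) a * dpow (F I2) b * dpow (F I1) c) \<eta>"

definition Bmon ::
    "(idx \<Rightarrow> int) \<Rightarrow> (Uq \<Rightarrow> 'v \<Rightarrow> 'v::ab_group_add) \<Rightarrow> 'v \<Rightarrow> int \<Rightarrow> int \<Rightarrow> int \<Rightarrow> 'v" where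
  "Bmon \<sigma> act \<eta> a b c = act (dpow (B \<sigma> I1) a * dpow (B \<sigma> I2) b * dpow (B \<sigma> I1) c) \<eta>"

definition icb_coset :: "(Uq \<Rightarrow> 'v \<Rightarrow> 'v::ab_group_add) \<Rightarrow> 'v \<Rightarrow> int \<Rightarrow> int \<Rightarrow> int \<Rightarrow> 'v set" where
  "icb_coset act \<eta> a b c =
     {Fmon act \<eta> a b c +
        (\<Sum>(x, y)\<in>S. act (scal (d x y)) (Fmon act \<eta> (a - int x) (b - int x - int y) (c - int y)))
      | (S :: (nat \<times> nat) set) (d :: nat \<Rightarrow> nat \<Rightarrow> Qq).
        finite S \<and> (0, 0) \<notin> S \<and> (\<forall>x y. d x y \<in> qinv_int_polys)}"

text \<open>Meaningful for \<open>a, b, c \<ge> 0\<close> with \<open>b \<ge> a + c\<close> and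
  \<open>Fmon act \<eta> a b c \<noteq> 0\<close>.\<close>

definition icb ::
    "(Uq \<Rightarrow> 'v \<Rightarrow> 'v::ab_group_add) \<Rightarrow> 'v \<Rightarrow> ('v \<Rightarrow> 'v) \<Rightarrow> int \<Rightarrow> int \<Rightarrow> int \<Rightarrow> 'v" where
  "icb act \<eta> psiL a b c = (THE v. v \<in> icb_coset act \<eta> a b c \<and> psiL v = v)"

text \<open>The coefficients of the first expansion for even and odd k.  The even one is
  \<open>[\<beta>][\<beta>-k+2]\<cdots>[\<beta>+k-2] / [k]!\<close> with \<open>k-1\<close> factors after the
  prefactor, and 1 for \<open>k = 0\<close> by convention.\<close>

definition even_coeff :: "int \<Rightarrow> nat \<Rightarrow> Qq" where
  "even_coeff \<beta> k =
     (if k = 0 then 1 else qint \<beta> * (qprod (\<beta> - int k + 2) (k - 1) / qfact k))"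

definition odd_coeff :: "int \<Rightarrow> nat \<Rightarrow> Qq" where
  "odd_coeff \<beta> k = qprod (\<beta> - int k + 1) k / qfact k"

end

theory Submission
  imports Defs
begin

text \<open>On the monomials \<open>F\<^sub>1\<^sup>(\<^sup>a\<^sup>)F\<^sub>2\<^sup>(\<^sup>b\<^sup>)F\<^sub>1\<^sup>(\<^sup>c\<^sup>)\<eta>\<close> both generators act by
  two-term rules.  Passing from \<open>(a, b, c)\<close> to \<open>(a - k, b - k, c)\<close> replaces \<open>\<beta>\<close> by \<open>\<beta> + k\<close> and
  keeps \<open>d = n + c - b - \<beta> + 1 \<ge> 0\<close>, and
  \<open>B\<^sub>1\<^sup>(\<^sup>a\<^sup>-\<^sup>k\<^sup>)B\<^sub>2\<^sup>(\<^sup>b\<^sup>-\<^sup>k\<^sup>)B\<^sub>1\<^sup>(\<^sup>c\<^sup>)\<eta> = \<Sum>z. p(\<beta> + k, z - k) G\<^sub>z\<close> with vectors \<open>G\<^sub>z\<close> independent of \<open>k\<close>.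
  The coefficients satisfy \<open>p(\<beta>, z) = (\<Sum>j. A(\<beta>, j) s(\<beta> + j, z - j))\<close>, where \<open>A\<close> are the bar invariant
  transition coefficients of the theorem, extended to odd \<open>\<beta>\<close>, and \<open>s(\<beta>, z)\<close> is an integral polynomial in
  the inverse of \<open>q\<close>, without constant term if \<open>z > 0\<close>.  Hence \<open>V\<^sub>k = (\<Sum>z. s(\<beta> + k, z - k) G\<^sub>z)\<close> has the
  shape required of an icanonical basis element, and it is invariant by downward induction on \<open>k\<close>.
  The second formula inverts the first by alternating sums of quantum binomial coefficients.
  Uniqueness of the icanonical basis rests on the linear independence of the monomials, which the words
  \<open>E\<^sub>2\<^sup>b\<^sup>-\<^sup>jE\<^sub>1\<^sup>aE\<^sub>2\<^sup>j\<close> turn into the regularity of a Hankel matrix of quantum factorials.\<close>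

section \<open>Quantum integers, their products, and the effect of the bar involution\<close>

section \<open>Quantum integers\<close>

lemma q_powi_add: "q powi (x + y) = q powi x * q powi y"
  by (simp add: power_int_add)

lemma q_powi_diff: "q powi (x - y) = q powi x / q powi y"
  by (simp add: power_int_diff)

lemma q_power_eq: "q ^ n = to_fract (monom 1 n)"
  by (induction n) (simp_all add: q_def monom_Suc flip: to_fract_mult one_pCons)

lemma q_power_neq_1:
  assumes "n > 0"
  shows "q ^ n \<noteq> 1"
proof
  assume "q ^ n = 1"
  then have "to_fract (monom 1 n) = to_fract (1 :: rat poly)"
    by (simp add: q_power_eq)
  then have "degree (monom (1 :: rat) n) = degree (1 :: rat poly)"
    by (metis to_fract_eq_iff)
  then show False using assms by (simp add: degree_monom_eq)
qed

lemma q_diff_nz [simp]: "q - inverse q \<noteq> 0"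
proof
  assume "q - inverse q = 0"
  then have "q ^ 2 = 1"
    by (metis eq_iff_diff_eq_0 power2_eq_square q_nonzero right_inverse)
  then show False using q_power_neq_1[of 2] by simp
qed

lemma q_powi_eq_1_iff: "q powi x = 1 \<longleftrightarrow> x = 0"
proof
  assume *: "q powi x = 1"
  show "x = 0"
  proof (rule ccontr)
    assume "x \<noteq> 0"
    then have "nat \<bar>x\<bar> > 0" by simp
    moreover have "q ^ nat \<bar>x\<bar> = 1"
    proof (cases "x \<ge> 0")
      case True
      then show ?thesis using * by (simp add: power_int_def)
    next
      case False
      then show ?thesis using * by (simp add: power_int_def power_inverse)
    qed
    ultimately show False using q_power_neq_1 by blast
  qed
qed simp

lemma q_neq_inverse [simp]: "q \<noteq> inverse q"
  using q_diff_nz by (metis diff_self)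

lemma qint_0 [simp]: "qint 0 = 0"
  by (simp add: qint_def)

lemma qint_1 [simp]: "qint 1 = 1"
  by (simp add: qint_def)

lemma qint_minus: "qint (- x) = - qint x"
  by (simp add: qint_def minus_divide_left)

lemma qint_eq_0_iff [simp]: "qint x = 0 \<longleftrightarrow> x = 0"
proof
  assume "qint x = 0"
  then have "q powi x = q powi (- x)"
    by (simp add: qint_def)
  then have "q powi (x + x) = q powi (- x + x)"
    unfolding q_powi_add by simp
  then have "q powi (x + x) = 1" by simp
  then show "x = 0" by (simp add: q_powi_eq_1_iff)
qed simp

text \<open>The Pascal-type recursions for \<open>gb\<close>, \<open>gauss\<close> and
  \<open>hcoef\<close> all come from splitting one quantum integer in this way.\<close>

lemma qint_add: "qint (x + y) = q powi y * qint x + q powi (- x) * qint y"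
proof -
  have "q powi (x + y) - q powi (- (x + y)) =
      q powi y * (q powi x - q powi (- x)) + q powi (- x) * (q powi y - q powi (- y))"
    by (simp add: q_powi_add q_powi_diff power_int_minus divide_inverse algebra_simps)
  then show ?thesis
    by (simp add: qint_def add_divide_distrib)
qed

text \<open>Multiplied by (q - q^-1)^2, both sides become the same Laurent polynomial in q^x, q^y,
  q^z. This relation drives the Hankel elimination, the recursion of \<open>E1_coeff\<close> and the
  commutator of E with divided powers of F.\<close>

lemma qint_three: "qint (x + y) * qint z = qint y * qint (z + x) + qint x * qint (z - y)"
proof -
  define h where "h = q - inverse q"
  have h: "h \<noteq> 0" by (simp add: h_def)
  have *: "qint u * h = q powi u - inverse (q powi u)" for u
    by (simp add: qint_def h_def power_int_minus)
  have "(qint (x + y) * h) * (qint z * h) =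
      (qint y * h) * (qint (z + x) * h) + (qint x * h) * (qint (z - y) * h)"
    unfolding * q_powi_add q_powi_diff by (simp add: field_simps)
  then have "(qint (x + y) * qint z) * (h * h) =
      (qint y * qint (z + x) + qint x * qint (z - y)) * (h * h)"
    by (simp add: algebra_simps)
  then show ?thesis using h by simp
qed

lemma qfact_0 [simp]: "qfact 0 = 1"
  by (simp add: qfact_def)

lemma qfact_Suc: "qfact (Suc k) = qint (int k + 1) * qfact k"
  by (simp add: qfact_def add.commute mult.commute)

lemma qfact_nz [simp]: "qfact k \<noteq> 0"
  by (simp add: qfact_def)

lemma qprod_0 [simp]: "qprod r 0 = 1"
  by (simp add: qprod_def)

lemma qprod_Suc: "qprod r (Suc l) = qprod r l * qint (r + 2 * int l)"
  by (simp add: qprod_def)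

lemma qprod_add: "qprod r (l + l') = qprod r l * qprod (r + 2 * int l) l'"
  by (induction l') (simp_all add: qprod_Suc algebra_simps)

lemma qprod_Suc': "qprod r (Suc l) = qint r * qprod (r + 2) l"
  using qprod_add[of r 1 l] by (simp add: qprod_Suc)

lemma bar_0 [simp]: "bar 0 = 0"
  using bar_to_fract[of 0] by (simp add: eval_qinv_def)

lemma bar_1 [simp]: "bar 1 = 1"
  using bar_qconst[of 1] by simp

lemma bar_minus: "bar (- f) = - bar f"
  using bar_add[of f "- f"] by (simp add: add_eq_0_iff)

lemma bar_inverse: "bar (inverse f) = inverse (bar f)"
proof (cases "f = 0")
  case False
  then have "bar f * bar (inverse f) = 1"
    by (simp flip: bar_mult)
  then show ?thesis by (simp add: inverse_unique)
qed simp

lemma bar_divide: "bar (f / g) = bar f / bar g"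
  by (simp add: divide_inverse bar_mult bar_inverse)

lemma bar_power: "bar (f ^ n) = bar f ^ n"
  by (induction n) (simp_all add: bar_mult)

lemma bar_diff: "bar (f - g) = bar f - bar g"
  using bar_add[of f "- g"] by (simp add: bar_minus)

lemma bar_powi: "bar (q powi x) = q powi (- x)"
  by (simp add: power_int_def bar_power bar_inverse bar_q)

lemma bar_qint [simp]: "bar (qint x) = qint x"
proof -
  have "bar (qint x) = (q powi (- x) - q powi x) / (inverse q - q)"
    by (simp add: qint_def bar_divide bar_diff bar_powi bar_inverse bar_q)
  also have "\<dots> = qint x"
    unfolding qint_def by (metis minus_diff_eq minus_divide_divide)
  finally show ?thesis .
qed

lemma bar_prod: "bar (prod f A) = (\<Prod>i\<in>A. bar (f i))"
  by (induction A rule: infinite_finite_induct) (simp_all add: bar_mult)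

lemma bar_qfact [simp]: "bar (qfact k) = qfact k"
  by (simp add: qfact_def bar_prod)

lemma bar_qprod [simp]: "bar (qprod r l) = qprod r l"
  by (simp add: qprod_def bar_prod)

section \<open>The ring Z[q^-1], its ideal q^-1 Z[q^-1], and bar invariance\<close>

section \<open>Laurent polynomials without positive powers\<close>

definition qinv_polys :: "Qq set" where
  "qinv_polys = {poly (map_poly of_int p) (inverse q) | p :: int poly. True}"

lemma map_poly_of_int_add:
  "map_poly of_int (p + r :: int poly) = (map_poly of_int p + map_poly of_int r :: 'a :: comm_ring_1 poly)"
  by (rule poly_eqI) (simp add: coeff_map_poly)

lemma map_poly_of_int_mult:
  "map_poly of_int (p * r :: int poly) = (map_poly of_int p * map_poly of_int r :: 'a :: comm_ring_1 poly)"
  by (rule poly_eqI) (simp add: coeff_map_poly coeff_mult)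

lemma qinv_polys_add: "x \<in> qinv_polys \<Longrightarrow> y \<in> qinv_polys \<Longrightarrow> x + y \<in> qinv_polys"
  unfolding qinv_polys_def by clarify (metis map_poly_of_int_add poly_add)

lemma qinv_polys_mult: "x \<in> qinv_polys \<Longrightarrow> y \<in> qinv_polys \<Longrightarrow> x * y \<in> qinv_polys"
  unfolding qinv_polys_def by clarify (metis map_poly_of_int_mult poly_mult)

lemma qinv_polys_0 [simp]: "0 \<in> qinv_polys"
  unfolding qinv_polys_def by (auto intro: exI[of _ 0])

lemma qinv_polys_1 [simp]: "1 \<in> qinv_polys"
  unfolding qinv_polys_def by (auto intro!: exI[of _ 1])

lemma qinv_polys_minus: "x \<in> qinv_polys \<Longrightarrow> - x \<in> qinv_polys"
proof -
  assume "x \<in> qinv_polys"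
  moreover have "- 1 \<in> qinv_polys"
    unfolding qinv_polys_def by (auto intro!: exI[of _ "[:- 1:]"] simp: map_poly_pCons)
  ultimately show ?thesis using qinv_polys_mult by fastforce
qed

lemma qinv_polys_q: "inverse q \<in> qinv_polys"
  unfolding qinv_polys_def by (auto intro!: exI[of _ "[:0, 1:]"] simp: map_poly_pCons)

lemma qinv_polys_power: "inverse q ^ n \<in> qinv_polys"
  by (induction n) (auto intro: qinv_polys_mult qinv_polys_q)

lemma qinv_polys_powi: "x \<le> 0 \<Longrightarrow> q powi x \<in> qinv_polys"
  using qinv_polys_power[of "nat (- x)"] by (cases "x = 0") (auto simp: power_int_def)

lemma qinv_int_polys_iff: "x \<in> qinv_int_polys \<longleftrightarrow> (\<exists>y\<in>qinv_polys. x = inverse q * y)"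
  by (auto simp: qinv_int_polys_def qinv_polys_def)

lemma qinv_int_polys_subset: "x \<in> qinv_int_polys \<Longrightarrow> x \<in> qinv_polys"
  by (auto simp: qinv_int_polys_iff intro: qinv_polys_mult qinv_polys_q)

lemma qinv_int_polys_0 [simp]: "0 \<in> qinv_int_polys"
  by (auto simp: qinv_int_polys_iff intro: bexI[of _ 0])

lemma qinv_int_polys_add:
  assumes "x \<in> qinv_int_polys" "y \<in> qinv_int_polys"
  shows "x + y \<in> qinv_int_polys"
proof -
  from assms obtain u v where "u \<in> qinv_polys" "v \<in> qinv_polys" "x = inverse q * u" "y = inverse q * v"
    by (auto simp: qinv_int_polys_iff)
  then show ?thesis
    using qinv_polys_add[of u v] by (auto simp: qinv_int_polys_iff algebra_simps intro!: bexI[of _ "u + v"])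
qed

lemma qinv_int_polys_minus: "x \<in> qinv_int_polys \<Longrightarrow> - x \<in> qinv_int_polys"
  unfolding qinv_int_polys_iff by (metis mult_minus_right qinv_polys_minus)

lemma qinv_int_polys_diff: "x \<in> qinv_int_polys \<Longrightarrow> y \<in> qinv_int_polys \<Longrightarrow> x - y \<in> qinv_int_polys"
  using qinv_int_polys_add[of x "- y"] by (simp add: qinv_int_polys_minus)

lemma qinv_int_polys_mult: "x \<in> qinv_int_polys \<Longrightarrow> y \<in> qinv_polys \<Longrightarrow> x * y \<in> qinv_int_polys"
  unfolding qinv_int_polys_iff using qinv_polys_mult by (auto simp: mult.assoc)

lemma qinv_int_polys_powi:
  assumes "x < 0"
  shows "q powi x \<in> qinv_int_polys"
proof -
  have "q powi x = inverse q * q powi (x + 1)"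
    by (simp add: power_int_add)
  then show ?thesis
    using qinv_polys_powi[of "x + 1"] assms by (auto simp: qinv_int_polys_iff)
qed

lemma qconst_of_int: "qconst (of_int k) = of_int k"
proof -
  have "qconst (of_nat j) = of_nat j" for j
    by (induction j) (simp_all add: qconst_add)
  moreover have "qconst (- r) = - qconst r" for r
    using qconst_add[of r "- r"] by (simp add: add_eq_0_iff)
  ultimately show ?thesis
    by (cases k) (simp_all del: of_nat_Suc)
qed

lemma eval_qinv_pCons: "eval_qinv (pCons a p) = qconst a + inverse q * eval_qinv p"
  by (simp add: eval_qinv_def map_poly_pCons)

lemma bar_eval_qinv: "bar (eval_qinv p) = to_fract p"
proof (induction p)
  case 0
  then show ?case by (simp add: eval_qinv_def)
next
  case (pCons a p)
  have "to_fract (pCons a p) = qconst a + q * to_fract p"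
    using poly_qconst_q[of "pCons a p"] by (simp add: map_poly_pCons poly_qconst_q)
  then show ?case using pCons
    by (simp add: eval_qinv_pCons bar_add bar_mult bar_inverse bar_q bar_qconst)
qed

lemma to_fract_reflect_poly: "to_fract (reflect_poly p) = q ^ degree p * eval_qinv p"
proof -
  have deg: "degree (map_poly qconst p) = degree p"
    by (rule degree_map_poly) simp
  have "reflect_poly (map_poly qconst p) = map_poly qconst (reflect_poly p)"
    by (rule poly_eqI) (simp add: coeff_reflect_poly coeff_map_poly deg)
  then have "to_fract (reflect_poly p) = poly (reflect_poly (map_poly qconst p)) q"
    by (simp add: poly_qconst_q)
  then show ?thesis
    by (simp add: poly_reflect_poly_nz eval_qinv_def deg)
qed

text \<open>Write x = r(q^-1) with r(0) = 0. Invariance gives r(q) = r(q^-1); multiplied by q^(deg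
  r), this equates a polynomial of degree at most deg r with one of degree 2 deg r. So r is
  constant, hence zero. Uniqueness of icanonical elements rests on this.\<close>

lemma qinv_int_polys_bar_invariant:
  assumes "x \<in> qinv_int_polys" "bar x = x"
  shows "x = 0"
proof (rule ccontr)
  assume "x \<noteq> 0"
  from assms(1) obtain p :: "int poly"
    where x: "x = inverse q * poly (map_poly of_int p) (inverse q)"
    by (auto simp: qinv_int_polys_def)
  define r :: "rat poly" where "r = pCons 0 (map_poly of_int p)"
  have "map_poly qconst (map_poly of_int p) = map_poly of_int p"
    by (rule poly_eqI) (simp add: coeff_map_poly qconst_of_int)
  then have xr: "x = eval_qinv r"
    by (simp add: x r_def eval_qinv_pCons) (simp add: eval_qinv_def)
  with \<open>x \<noteq> 0\<close> have "r \<noteq> 0" by (auto simp: eval_qinv_def)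
  have "to_fract (reflect_poly r) = to_fract (monom 1 (degree r) * r)"
    using assms(2) by (simp add: to_fract_reflect_poly xr bar_eval_qinv q_power_eq)
  then have "reflect_poly r = monom 1 (degree r) * r"
    by (metis to_fract_eq_iff)
  then have "degree (monom 1 (degree r) * r) \<le> degree r"
    by (metis degree_reflect_poly_le)
  moreover have "degree (monom 1 (degree r) * r) = degree r + degree r"
    using \<open>r \<noteq> 0\<close> by (simp add: degree_mult_eq degree_monom_eq)
  ultimately have "degree r = 0" by simp
  then show False using \<open>r \<noteq> 0\<close> by (simp add: r_def split: if_splits)
qed

section \<open>Regularity of a Hankel matrix of quantum factorials\<close>

section \<open>A Hankel system\<close>

lemma qint_eq_fact_step: "qint (int k) * qfact (k - 1) = qfact k" if "k > 0"
  using that by (cases k) (simp_all add: qfact_Suc add.commute)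

text \<open>A combination of the equations for \<open>j\<close> and \<open>j + 1\<close> eliminates the last unknown and has
  the same shape with \<open>r - 1\<close> in place of \<open>r\<close>.\<close>

lemma hankel_independent:
  fixes c :: "nat \<Rightarrow> Qq"
  assumes "2 * N \<le> r"
    and "\<And>j. j \<le> N \<Longrightarrow> (\<Sum>i\<le>N. c i * (qfact (p + i + j) * qfact (r - i - j))) = 0"
    and "i \<le> N"
  shows "c i = 0"
  using assms
proof (induction N arbitrary: r c i)
  case 0
  then show ?case using 0(2)[of 0] by simp
next
  case (Suc N)
  let ?N = "Suc N"
  \<comment> \<open>The factor vanishes at the last index and nowhere below it: the last unknown
    drops out, and \<open>c' i = 0\<close> still yields \<open>c i = 0\<close> for the
    others.\<close>
  define c' where "c' i = c i * qint (int i - int ?N)" for i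
  have "c' i = 0" if "i \<le> N" for i
  proof (rule Suc.IH[OF _ _ that])
    show "2 * N \<le> r - 1" using Suc.prems(1) by simp
  next
    fix j assume j: "j \<le> N"
    \<comment> \<open>These multipliers of two neighbouring equations are chosen so that
      \<open>qint_three\<close> produces [i - (N + 1)] times [p + r + 1]; the latter is nonzero and
      does not depend on i or j.\<close>
    define \<alpha> where "\<alpha> = qint (int r - int ?N - int j)"
    define \<gamma> where "\<gamma> = qint (int p + int ?N + int j + 1)"
    have "qint (int p + int r + 1) * (\<Sum>i\<le>N. c' i * (qfact (p + i + j) * qfact (r - 1 - i - j))) =
        qint (int p + int r + 1) * (\<Sum>i\<le>?N. c' i * (qfact (p + i + j) * qfact (r - 1 - i - j)))"
      by (simp add: c'_def)
    also have "\<dots> = \<alpha> * (\<Sum>i\<le>?N. c i * (qfact (p + i + Suc j) * qfact (r - i - Suc j)))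
        - \<gamma> * (\<Sum>i\<le>?N. c i * (qfact (p + i + j) * qfact (r - i - j)))"
      unfolding sum_distrib_left sum_subtractf[symmetric]
    proof (rule sum.cong[OF HOL.refl])
      fix i assume i: "i \<in> {..?N}"
      have ij: "i + j < r" using i j Suc.prems(1) by auto
      have f1: "qfact (p + i + Suc j) = qint (int p + int i + int j + 1) * qfact (p + i + j)"
        by (simp add: qfact_Suc)
      have f2: "qfact (r - i - j) = qint (int r - int i - int j) * qfact (r - 1 - i - j)"
        using qint_eq_fact_step[of "r - i - j"] ij by (simp add: of_nat_diff algebra_simps)
      have f3: "qint (int p + int r + 1) * qint (int i - int ?N) =
          \<alpha> * qint (int p + int i + int j + 1) - \<gamma> * qint (int r - int i - int j)"
      proof -
        define x where "x = int p + int ?N + int j + 1"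
        define y where "y = int r - int ?N - int j"
        define z where "z = int i - int ?N"
        have e: "x + y = int p + int r + 1" "z + x = int p + int i + int j + 1"
          "z - y = - (int r - int i - int j)"
          by (simp_all add: x_def y_def z_def)
        have "qint (int p + int r + 1) * qint z =
            qint y * qint (int p + int i + int j + 1) - qint x * qint (int r - int i - int j)"
          using qint_three[of x y z] unfolding e qint_minus by simp
        then show ?thesis by (simp only: \<alpha>_def \<gamma>_def x_def y_def z_def)
      qed
      have "qint (int p + int r + 1) * (c' i * (qfact (p + i + j) * qfact (r - 1 - i - j))) =
          c i * (qfact (p + i + j) * qfact (r - 1 - i - j)) * (qint (int p + int r + 1) * qint (int i - int ?N))"
        by (simp add: c'_def)
      also have "\<dots> = \<alpha> * (c i * (qfact (p + i + Suc j) * qfact (r - 1 - i - j)))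
          - \<gamma> * (c i * (qfact (p + i + j) * qfact (r - i - j)))"
        unfolding f1 f2 f3 by (simp add: algebra_simps)
      finally show "qint (int p + int r + 1) * (c' i * (qfact (p + i + j) * qfact (r - 1 - i - j))) =
          \<alpha> * (c i * (qfact (p + i + Suc j) * qfact (r - i - Suc j)))
          - \<gamma> * (c i * (qfact (p + i + j) * qfact (r - i - j)))"
        by (simp add: diff_right_commute)
    qed
    also have "\<dots> = 0"
      using Suc.prems(2)[of j] Suc.prems(2)[of "Suc j"] j by simp
    finally show "(\<Sum>i\<le>N. c' i * (qfact (p + i + j) * qfact (r - 1 - i - j))) = 0"
      by (simp add: add_nonneg_eq_0_iff)
  qed
  then have *: "c i = 0" if "i \<le> N" for i
    using that by (auto simp: c'_def)
  moreover have "c ?N = 0"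
    using Suc.prems(2)[of 0] * by simp
  ultimately show ?case using Suc.prems(3) by (metis le_Suc_eq)
qed

section \<open>Quantum binomials, the coefficients \<open>pcoef\<close> and their integral
  counterparts \<open>scoef\<close>\<close>

section \<open>The coefficients of the monomial expansions\<close>

text \<open>The quantum binomial coefficient N + x over x, as a product so that N can be any
  integer.\<close>

definition gb :: "int \<Rightarrow> nat \<Rightarrow> Qq" where
  "gb N x = (\<Prod>i<x. qint (N + 1 + int i)) / qfact x"

definition tri :: "nat \<Rightarrow> nat" where
  "tri x = x * (x + 1) div 2"

lemma tri_0 [simp]: "tri 0 = 0"
  and tri_Suc: "tri (Suc x) = tri x + Suc x"
  by (simp_all add: tri_def)

lemma gb_0 [simp]: "gb N 0 = 1"
  by (simp add: gb_def)

lemma gb_Suc: "qint (int x + 1) * gb N (Suc x) = qint (N + 1 + int x) * gb N x"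
  by (simp add: gb_def qfact_Suc)

lemma gb_Suc': "qint (int x + 1) * gb N (Suc x) = qint (N + 1) * gb (N + 1) x"
  by (simp add: gb_def qfact_Suc prod.lessThan_Suc_shift algebra_simps del: prod.lessThan_Suc)

text \<open>Split [(N + 1) + (x + 1)] by \<open>qint_add\<close>. One summand is rewritten by
  \<open>gb_Suc'\<close>; then both carry the factor [x + 1], which cancels.\<close>

lemma gb_pascal: "gb (N + 1) (Suc x) = q powi (int x + 1) * gb N (Suc x) + q powi (- N - 1) * gb (N + 1) x"
proof -
  have "qint (int x + 1) * gb (N + 1) (Suc x) = qint ((N + 1) + (int x + 1)) * gb (N + 1) x"
    using gb_Suc[of x "N + 1"] by (simp add: ac_simps)
  also have "\<dots> = q powi (int x + 1) * (qint (N + 1) * gb (N + 1) x)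
      + qint (int x + 1) * (q powi (- (N + 1)) * gb (N + 1) x)"
    by (subst qint_add) (simp add: algebra_simps)
  also have "\<dots> = qint (int x + 1) * (q powi (int x + 1) * gb N (Suc x) + q powi (- N - 1) * gb (N + 1) x)"
    by (subst gb_Suc'[symmetric]) (simp add: semiring_class.distrib_left mult.left_commute)
  finally show ?thesis by (simp add: add_eq_0_iff)
qed

text \<open>With \<open>N = \<beta> + d - 1\<close>, this is the coefficient that \<open>x\<close> applications of the second
  summand of the first generator contribute to \<open>B\<^sub>1\<^sup>(\<^sup>a\<^sup>)\<close>.\<close>

definition pcoef :: "nat \<Rightarrow> int \<Rightarrow> nat \<Rightarrow> Qq" where
  "pcoef d \<beta> x = q powi (int x * (1 - int d) - int (tri x)) * gb (\<beta> + int d - 1) x"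

lemma pcoef_0 [simp]: "pcoef d \<beta> 0 = 1"
  by (simp add: pcoef_def)

text \<open>Pascal's rule for \<open>gb\<close>: the prefactor of \<open>pcoef\<close> is normalised
  so that the first power of q is absorbed when d grows by one.\<close>

lemma pcoef_Suc:
  "pcoef (Suc d) \<beta> (Suc x) =
     pcoef d \<beta> (Suc x) + q powi (- (\<beta> + int (Suc x) + 2 * int d)) * pcoef (Suc d) \<beta> x"
proof -
  have N: "\<beta> + int (Suc d) - 1 = (\<beta> + int d - 1) + 1" by simp
  have e1: "int (Suc x) * (1 - int (Suc d)) - int (tri (Suc x)) + (int x + 1)
      = int (Suc x) * (1 - int d) - int (tri (Suc x))"
    by (simp add: algebra_simps)
  have e2: "int (Suc x) * (1 - int (Suc d)) - int (tri (Suc x)) + (- (\<beta> + int d - 1) - 1)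
      = - (\<beta> + int (Suc x) + 2 * int d) + (int x * (1 - int (Suc d)) - int (tri x))"
    by (simp add: tri_Suc algebra_simps)
  show ?thesis
    unfolding pcoef_def N gb_pascal semiring_class.distrib_left[of "q powi (int (Suc x) * (1 - int (Suc d)) - int (tri (Suc x)))"]
      mult.assoc[symmetric] q_powi_add[symmetric] e1 e2
    by (rule HOL.refl)
qed

text \<open>The Gaussian binomial coefficient n over w in the variable q^-4. Its Pascal recursion,
  which involves no division, makes membership in Z[q^-1] immediate.\<close>

fun gauss :: "nat \<Rightarrow> nat \<Rightarrow> Qq" where
  "gauss n 0 = 1"
| "gauss 0 (Suc w) = 0"
| "gauss (Suc n) (Suc w) = gauss n w + q powi (- 4 * (int w + 1)) * gauss n (Suc w)"

lemma gauss_qinv_polys: "gauss n w \<in> qinv_polys"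
  by (induction n w rule: gauss.induct)
    (auto intro!: qinv_polys_add qinv_polys_mult qinv_polys_powi)

definition evfact :: "nat \<Rightarrow> Qq" where
  "evfact w = (\<Prod>i<w. qint (2 * int i + 2))"

lemma evfact_0 [simp]: "evfact 0 = 1"
  and evfact_Suc: "evfact (Suc w) = evfact w * qint (2 * int w + 2)"
  by (simp_all add: evfact_def)

lemma evfact_nz [simp]: "evfact w \<noteq> 0"
  by (simp add: evfact_def)

lemma prod_qint_down: "(\<Prod>j<l. qint (u - 2 * int j)) = qprod (u - 2 * int l + 2) l"
proof (induction l)
  case (Suc l)
  have "qprod (u - 2 * int (Suc l) + 2) (Suc l) = qint (u - 2 * int l) * qprod (u - 2 * int l + 2) l"
    by (simp add: qprod_Suc' algebra_simps)
  then show ?case using Suc by simp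
qed simp

text \<open>Divided by \<open>evfact w\<close>, the left side is the balanced binomial coefficient n
  over w at q^2, with top power q^(2w(n - w)); taking this power out leaves a polynomial in q^-4.
  Both sides vanish for w > n.\<close>

lemma gauss_eq:
  "(\<Prod>j<w. qint (2 * int n - 2 * int j)) = gauss n w * q powi (2 * int w * (int n - int w)) * evfact w"
proof (induction n w rule: gauss.induct)
  case (2 w)
  then show ?case by (simp add: prod.lessThan_Suc_shift del: prod.lessThan_Suc)
next
  case (3 n w)
  let ?A = "\<Prod>j<w. qint (2 * int n - 2 * int j)"
  have "(\<Prod>j<Suc w. qint (2 * int (Suc n) - 2 * int j)) = qint ((2 * int w + 2) + (2 * int n - 2 * int w)) * ?A"
    by (simp add: prod.lessThan_Suc_shift algebra_simps del: prod.lessThan_Suc)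
  also have "\<dots> = q powi (2 * int n - 2 * int w) * qint (2 * int w + 2) * ?A
      + q powi (- (2 * int w + 2)) * (\<Prod>j<Suc w. qint (2 * int n - 2 * int j))"
    by (subst qint_add) (simp add: algebra_simps)
  also have "\<dots> = gauss n w * (q powi (2 * int n - 2 * int w) * q powi (2 * int w * (int n - int w))) * evfact (Suc w)
      + gauss n (Suc w) * (q powi (- (2 * int w + 2)) * q powi (2 * int (Suc w) * (int n - int (Suc w)))) * evfact (Suc w)"
    by (simp only: 3 evfact_Suc) (simp only: mult_ac)
  also have "q powi (2 * int n - 2 * int w) * q powi (2 * int w * (int n - int w)) =
      q powi (2 * int (Suc w) * (int (Suc n) - int (Suc w)))"
    unfolding q_powi_add[symmetric] by (rule arg_cong[where f = "\<lambda>x. q powi x"]) (simp add: algebra_simps)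
  also have "q powi (- (2 * int w + 2)) * q powi (2 * int (Suc w) * (int n - int (Suc w))) =
      q powi (- 4 * (int w + 1)) * q powi (2 * int (Suc w) * (int (Suc n) - int (Suc w)))"
    unfolding q_powi_add[symmetric] by (rule arg_cong[where f = "\<lambda>x. q powi x"]) (simp add: algebra_simps)
  finally show ?case by (simp add: algebra_simps)
qed simp

text \<open>The values for \<open>d = 0\<close>: up to a power of \<open>q\<close>, a Gaussian binomial coefficient in \<open>q\<^sup>-\<^sup>4\<close>
  with lower index \<open>x div 2\<close>.\<close>

definition scoef0 :: "int \<Rightarrow> nat \<Rightarrow> Qq" where
  "scoef0 \<beta> x = (if odd x then 0 else
     let w = x div 2; u = (if even \<beta> then \<beta> + int x else \<beta> + int x - 1);
         t = (if even \<beta> then u - 2 else u)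
     in q powi (- (int w * (u - 1))) * (\<Prod>j<w. qint (t - 2 * int j)) / evfact w)"

lemma scoef0_0 [simp]: "scoef0 \<beta> 0 = 1"
  by (simp add: scoef0_def)

text \<open>With x = 2w, inserting \<open>gauss_eq\<close> leaves q to the power -w(2w + 1) for even
  \<beta> and -w(2w - 1) for odd \<beta>, both negative for w > 0.\<close>

lemma scoef0_qinv_int_polys:
  assumes "\<beta> > 0" "x > 0"
  shows "scoef0 \<beta> x \<in> qinv_int_polys"
proof (cases "odd x")
  case True
  then show ?thesis by (simp add: scoef0_def)
next
  case False
  then obtain w where x: "x = 2 * w" by auto
  with assms have w: "w > 0" by simp
  show ?thesis
  proof (cases "even \<beta>")
    case True
    define n where "n = nat ((\<beta> + int x - 2) div 2)"
    have n: "\<beta> + int x - 2 = 2 * int n"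
      using True assms by (auto simp: n_def x)
    then have u: "\<beta> + int x = 2 * int n + 2" by simp
    have "scoef0 \<beta> x = (q powi (- (int w * (2 * int n + 1))) * q powi (2 * int w * (int n - int w))) * gauss n w"
      using True unfolding scoef0_def Let_def u
      by (simp add: x gauss_eq add.commute)
    also have "q powi (- (int w * (2 * int n + 1))) * q powi (2 * int w * (int n - int w))
        = q powi (- (int w * (2 * int w + 1)))"
      unfolding q_powi_add[symmetric] by (rule arg_cong[where f = "\<lambda>x. q powi x"]) (simp add: algebra_simps)
    finally show ?thesis
      using w by (auto intro!: qinv_int_polys_mult qinv_int_polys_powi gauss_qinv_polys)
  next
    case False
    define n where "n = nat ((\<beta> + int x - 1) div 2)"
    have n: "\<beta> + int x - 1 = 2 * int n"
      using False assms by (auto simp: n_def x)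
    have "scoef0 \<beta> x = (q powi (- (int w * (2 * int n - 1))) * q powi (2 * int w * (int n - int w))) * gauss n w"
      using False unfolding scoef0_def Let_def n
      by (simp add: x gauss_eq)
    also have "q powi (- (int w * (2 * int n - 1))) * q powi (2 * int w * (int n - int w))
        = q powi (- (int w * (2 * int w - 1)))"
      unfolding q_powi_add[symmetric] by (rule arg_cong[where f = "\<lambda>x. q powi x"]) (simp add: algebra_simps)
    finally show ?thesis
      using w by (auto intro!: qinv_int_polys_mult qinv_int_polys_powi gauss_qinv_polys)
  qed
qed

text \<open>The same recursion in \<open>d\<close> as in \<open>pcoef_Suc\<close>; its coefficients depend on \<open>\<beta>\<close> and \<open>x\<close> only
  through \<open>\<beta> + x\<close>, so it is compatible with convolution by the transition coefficients.\<close>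

fun scoef :: "nat \<Rightarrow> int \<Rightarrow> nat \<Rightarrow> Qq" where
  "scoef 0 \<beta> x = scoef0 \<beta> x"
| "scoef (Suc d) \<beta> 0 = 1"
| "scoef (Suc d) \<beta> (Suc x) =
     scoef d \<beta> (Suc x) + q powi (- (\<beta> + int (Suc x) + 2 * int d)) * scoef (Suc d) \<beta> x"

lemma scoef_0 [simp]: "scoef d \<beta> 0 = 1"
  by (cases d) simp_all

text \<open>Positivity of \<beta> makes every power of q in the recursion negative, so the property
  passes from d = 0 to all d.\<close>

lemma scoef_qinv_int_polys:
  assumes "\<beta> > 0"
  shows "x > 0 \<Longrightarrow> scoef d \<beta> x \<in> qinv_int_polys"
  using assms
proof (induction d \<beta> x rule: scoef.induct)
  case (3 d \<beta> x)
  have "scoef (Suc d) \<beta> x \<in> qinv_polys"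
    using 3 by (cases "x = 0") (auto intro: qinv_int_polys_subset)
  moreover have "scoef d \<beta> (Suc x) \<in> qinv_int_polys" using 3 by simp
  ultimately show ?case
    using 3 by (auto intro!: qinv_int_polys_add qinv_int_polys_mult qinv_int_polys_powi)
qed (auto intro: scoef0_qinv_int_polys)

section \<open>Transition coefficients and the factorisation of \<open>pcoef\<close> through
  them\<close>

section \<open>The transition coefficients\<close>

text \<open>For odd \<open>\<beta>\<close> the two kinds of coefficients swap roles, so that the factors that run in steps of 2
  always have even arguments.\<close>

definition acoef :: "int \<Rightarrow> nat \<Rightarrow> Qq" where
  "acoef \<beta> k = (if even (\<beta> + int k) then even_coeff \<beta> k else odd_coeff \<beta> k)"

lemma acoef_0 [simp]: "acoef \<beta> 0 = 1"
  by (simp add: acoef_def even_coeff_def odd_coeff_def)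

lemma bar_acoef [simp]: "bar (acoef \<beta> k) = acoef \<beta> k"
  by (simp add: acoef_def even_coeff_def odd_coeff_def bar_mult bar_divide)

text \<open>A quantum analogue of z! / ((z - 2w)! 2^w w!), the number of sets of w disjoint pairs
  among z points.\<close>

definition hcoef :: "nat \<Rightarrow> nat \<Rightarrow> Qq" where
  "hcoef z w = (if 2 * w \<le> z then qfact z / (qfact (z - 2 * w) * evfact w) else 0)"

lemma hcoef_0 [simp]: "hcoef z 0 = 1"
  by (simp add: hcoef_def)

text \<open>At q = 1: the new point is left single, or is paired with one of the z - 2w points
  outside the other w pairs. For general q the two cases come from splitting [z + 1] as
  [(2w + 2) + (z - 2w - 1)]; the small values of z are boundary cases.\<close>

lemma hcoef_Suc:
  "hcoef (Suc z) (Suc w) = q powi (- 2 * int (Suc w)) * hcoef z (Suc w)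
     + q powi (int z - 2 * int w - 1) * (qint (int z - 2 * int w) * hcoef z w)"
proof -
  consider "2 * w + 2 \<le> z" | "z = 2 * w + 1" | "z = 2 * w" | "z < 2 * w" by linarith
  then show ?thesis
  proof cases
    case 1
    then obtain y where z: "z = y + 2 * w + 2" by (metis add.commute add.left_commute le_Suc_ex)
    have "hcoef (Suc z) (Suc w) = qint ((int y + 1) + (2 * int w + 2)) * qfact z / (qfact (Suc y) * evfact (Suc w))"
      by (simp add: hcoef_def z qfact_Suc algebra_simps)
    also have "\<dots> = qint ((2 * int w + 2) + (int y + 1)) * qfact z / (qfact (Suc y) * evfact (Suc w))"
      by (simp only: add.commute)
    also have "\<dots> = q powi (- (2 * int w + 2)) * (qint (int y + 1) * qfact z / (qfact (Suc y) * evfact (Suc w)))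
        + q powi (int y + 1) * (qint (2 * int w + 2) * qfact z / (qfact (Suc y) * evfact (Suc w)))"
      by (subst qint_add) (simp add: algebra_simps add_divide_distrib)
    also have "qint (int y + 1) * qfact z / (qfact (Suc y) * evfact (Suc w)) = hcoef z (Suc w)"
      by (simp add: hcoef_def z qfact_Suc)
    also have "qint (2 * int w + 2) * qfact z / (qfact (Suc y) * evfact (Suc w)) =
        qint (int z - 2 * int w) * hcoef z w"
      by (simp add: hcoef_def z evfact_Suc qfact_Suc)
    also have "- (2 * int w + 2) = - 2 * int (Suc w)" by simp
    also have "int y + 1 = int z - 2 * int w - 1" by (simp add: z)
    finally show ?thesis .
  next
    case 2
    then show ?thesis
      by (simp add: hcoef_def qfact_Suc evfact_Suc add.commute)
  next
    case 3
    then show ?thesis by (simp add: hcoef_def)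
  next
    case 4
    then show ?thesis by (simp add: hcoef_def)
  qed
qed

text \<open>Converts a product of consecutive quantum integers into products in steps of 2, the kind
  occurring in \<open>acoef\<close> and \<open>scoef0\<close>. Induction on z, with
  \<open>hcoef_Suc\<close> collecting the terms.\<close>

lemma falling_qprod_expansion:
  "(\<Prod>t<z. q powi (- int t) * qint (u - int t)) =
     (\<Sum>w\<le>z. hcoef z w * q powi (- (int w * (u - 1))) * (\<Prod>j<z - w. qint (u - 2 * int j)))"
proof (induction z)
  case (Suc z)
  define T where "T l = (\<Prod>j<l. qint (u - 2 * int j))" for l
  define Q where "Q w = q powi (- (int w * (u - 1)))" for w :: nat
  \<comment> \<open>The new factor is split at u - 2(z - w), the next argument of the product in
    steps of 2. One part lengthens that product; the other raises w and keeps the length, since z -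
    w = Suc z - Suc w.\<close>
  have step: "hcoef z w * Q w * T (z - w) * (q powi (- int z) * qint (u - int z)) =
      q powi (- 2 * int w) * hcoef z w * Q w * T (Suc z - w)
      + q powi (int z - 2 * int w - 1) * (qint (int z - 2 * int w) * hcoef z w) * Q (Suc w) * T (Suc z - Suc w)"
    if w: "w \<le> z" for w
  proof -
    have "q powi (- int z) * qint (u - int z) =
        q powi (- int z) * qint ((u - 2 * int (z - w)) + (int z - 2 * int w))"
      using w by (simp add: of_nat_diff algebra_simps)
    also have "\<dots> = (q powi (- int z) * q powi (int z - 2 * int w)) * qint (u - 2 * int (z - w))
        + (q powi (- int z) * q powi (- (u - 2 * int (z - w)))) * qint (int z - 2 * int w)"
      by (subst qint_add) (simp add: algebra_simps)
    also have "q powi (- int z) * q powi (int z - 2 * int w) = q powi (- 2 * int w)"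
      unfolding q_powi_add[symmetric] by simp
    also have "q powi (- int z) * q powi (- (u - 2 * int (z - w))) =
        q powi (int z - 2 * int w - 1) * q powi (- (u - 1))"
      unfolding q_powi_add[symmetric] using w
      by (intro arg_cong[where f = "\<lambda>x. q powi x"]) (simp add: of_nat_diff algebra_simps)
    finally have e: "q powi (- int z) * qint (u - int z) =
        q powi (- 2 * int w) * qint (u - 2 * int (z - w))
        + q powi (int z - 2 * int w - 1) * q powi (- (u - 1)) * qint (int z - 2 * int w)" .
    have T: "T (Suc z - w) = T (z - w) * qint (u - 2 * int (z - w))"
      using w by (simp add: T_def Suc_diff_le)
    have Q: "Q (Suc w) = Q w * q powi (- (u - 1))"
      unfolding Q_def q_powi_add[symmetric]
      by (rule arg_cong[where f = "\<lambda>x. q powi x"]) (simp add: algebra_simps)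
    show ?thesis unfolding e T Q diff_Suc_Suc by (simp add: algebra_simps)
  qed
  have "(\<Prod>t<Suc z. q powi (- int t) * qint (u - int t)) =
      (\<Sum>w\<le>z. hcoef z w * Q w * T (z - w)) * (q powi (- int z) * qint (u - int z))"
    using Suc.IH by (simp add: Q_def T_def)
  also have "\<dots> = (\<Sum>w\<le>z. q powi (- 2 * int w) * hcoef z w * Q w * T (Suc z - w))
      + (\<Sum>w\<le>z. q powi (int z - 2 * int w - 1) * (qint (int z - 2 * int w) * hcoef z w)
          * Q (Suc w) * T (Suc z - Suc w))"
    unfolding sum_distrib_right sum.distrib[symmetric] by (rule sum.cong) (simp_all only: step atMost_iff)
  \<comment> \<open>The extra term is zero because \<open>hcoef z (Suc z) = 0\<close>.\<close>
  also have "(\<Sum>w\<le>z. q powi (- 2 * int w) * hcoef z w * Q w * T (Suc z - w)) =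
      (\<Sum>w\<le>Suc z. q powi (- 2 * int w) * hcoef z w * Q w * T (Suc z - w))"
    by (simp add: hcoef_def)
  also have "\<dots> = T (Suc z) + (\<Sum>w\<le>z. q powi (- 2 * int (Suc w)) * hcoef z (Suc w) * Q (Suc w) * T (Suc z - Suc w))"
    by (subst sum.atMost_Suc_shift) (simp add: Q_def)
  also have "T (Suc z) + (\<Sum>w\<le>z. q powi (- 2 * int (Suc w)) * hcoef z (Suc w) * Q (Suc w) * T (Suc z - Suc w))
      + (\<Sum>w\<le>z. q powi (int z - 2 * int w - 1) * (qint (int z - 2 * int w) * hcoef z w)
          * Q (Suc w) * T (Suc z - Suc w)) =
      T (Suc z) + (\<Sum>w\<le>z. hcoef (Suc z) (Suc w) * Q (Suc w) * T (Suc z - Suc w))"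
    unfolding add.assoc sum.distrib[symmetric]
    by (intro arg_cong2[where f = "(+)"] sum.cong HOL.refl)
      (simp only: hcoef_Suc semiring_class.distrib_right)
  also have "\<dots> = (\<Sum>w\<le>Suc z. hcoef (Suc z) w * Q w * T (Suc z - w))"
    by (subst sum.atMost_Suc_shift) (simp add: Q_def)
  finally show ?case by (simp only: Q_def T_def)
qed simp

lemma prod_powi_neg: "(\<Prod>t<z. q powi (- int t)) = q powi (int z - int (tri z))"
  by (induction z) (simp_all add: tri_Suc flip: q_powi_add)

text \<open>With k = z - 2w, the numerator of \<open>acoef\<close> ends at \<beta> + k - 2 and the
  next product runs from \<beta> + k to \<beta> + z - 2. With [\<beta> + z] they join into one run
  in steps of 2; the detached factor [\<beta>] stays in front.\<close>

lemma qprod_even_split: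
  assumes "2 * w \<le> z" "even (\<beta> + int z)" "z > 0"
  shows "qint (\<beta> + int z) * acoef \<beta> (z - 2 * w) * (\<Prod>j<w. qint (\<beta> + int z - 2 - 2 * int j)) * qfact (z - 2 * w)
     = qint \<beta> * (\<Prod>j<z - w. qint (\<beta> + int z - 2 * int j))"
proof -
  define k where "k = z - 2 * w"
  have z: "z = k + 2 * w" using assms(1) by (simp add: k_def)
  have ev: "even (\<beta> + int k)" using assms(2) by (simp add: z)
  have p1: "(\<Prod>j<w. qint (\<beta> + int z - 2 - 2 * int j)) = qprod (\<beta> + int k) w"
    by (simp only: prod_qint_down) (simp add: z)
  have p2: "(\<Prod>j<z - w. qint (\<beta> + int z - 2 * int j)) = qprod (\<beta> - int k + 2) (k + w)"
    by (simp only: prod_qint_down) (simp add: z algebra_simps)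
  show ?thesis
  proof (cases "k = 0")
    \<comment> \<open>Here the coefficient is 1 by convention, so the factor [\<beta>] has to come
      from the run itself.\<close>
    case True
    have "qprod \<beta> (Suc w) = qprod \<beta> w * qint (\<beta> + 2 * int w)" by (rule qprod_Suc)
    moreover have "qprod \<beta> (Suc w) = qint \<beta> * qprod (\<beta> + 2) w" by (rule qprod_Suc')
    ultimately show ?thesis using True p1 p2 by (simp add: z)
  next
    case False
    then obtain l where k: "k = Suc l" by (cases k) auto
    have "qprod (\<beta> - int k + 2) (k + w) = qprod (\<beta> - int k + 2) (l + Suc w)"
      by (simp add: k)
    also have "\<dots> = qprod (\<beta> - int k + 2) l * qprod (\<beta> + int k) (Suc w)"
    proof -
      have "\<beta> - int k + 2 + 2 * int l = \<beta> + int k" by (simp add: k)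
      then show ?thesis by (simp only: qprod_add)
    qed
    also have "qprod (\<beta> + int k) (Suc w) = qprod (\<beta> + int k) w * qint (\<beta> + int z)"
      by (simp add: qprod_Suc z add.assoc)
    finally have "qprod (\<beta> - int k + 2) (k + w) =
        qprod (\<beta> - int k + 2) l * qprod (\<beta> + int k) w * qint (\<beta> + int z)" by simp
    moreover have "acoef \<beta> k * qfact k = qint \<beta> * qprod (\<beta> - int k + 2) l"
      using ev by (simp add: acoef_def even_coeff_def k)
    ultimately show ?thesis unfolding p1 p2 k_def[symmetric] by (simp add: mult_ac)
  qed
qed

lemma qprod_odd_split:
  assumes "2 * w \<le> z" "odd (\<beta> + int z)"
  shows "acoef \<beta> (z - 2 * w) * (\<Prod>j<w. qint (\<beta> + int z - 1 - 2 * int j)) * qfact (z - 2 * w)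
     = (\<Prod>j<z - w. qint (\<beta> + int z - 1 - 2 * int j))"
proof -
  define k where "k = z - 2 * w"
  have z: "z = k + 2 * w" using assms(1) by (simp add: k_def)
  have od: "odd (\<beta> + int k)" using assms(2) by (simp add: z)
  have p1: "(\<Prod>j<w. qint (\<beta> + int z - 1 - 2 * int j)) = qprod (\<beta> + int k + 1) w"
    by (simp only: prod_qint_down) (simp add: z add.commute add.left_commute)
  have p2: "(\<Prod>j<z - w. qint (\<beta> + int z - 1 - 2 * int j)) = qprod (\<beta> - int k + 1) (k + w)"
    by (simp only: prod_qint_down) (simp add: z algebra_simps)
  have "acoef \<beta> k * qfact k = qprod (\<beta> - int k + 1) k"
    using od by (simp add: acoef_def odd_coeff_def)
  then show ?thesis unfolding p1 p2 k_def[symmetric]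
    by (simp add: qprod_add mult_ac algebra_simps)
qed

text \<open>Only even z - j = 2w contribute. The split lemmas turn each summand into a term of
  \<open>falling_qprod_expansion\<close>, and the sum collapses to a product of consecutive quantum
  integers.\<close>

lemma pcoef_expansion_0:
  assumes "\<beta> > 0"
  shows "pcoef 0 \<beta> z = (\<Sum>j\<le>z. acoef \<beta> j * scoef0 (\<beta> + int j) (z - j))"
proof (cases "z = 0")
  case False
  \<comment> \<open>The largest argument, always even, in the products in steps of 2.\<close>
  define u where "u = (if even (\<beta> + int z) then \<beta> + int z else \<beta> + int z - 1)"
  define T where "T w = (if even (\<beta> + int z) then (\<Prod>j<w. qint (u - 2 - 2 * int j)) else (\<Prod>j<w. qint (u - 2 * int j)))" for w :: nat
  \<comment> \<open>For even \<beta> + z the resummed product runs from \<beta> + 1 to \<beta> + z;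
    this ratio moves it down to the range \<beta> to \<beta> + z - 1 of \<open>pcoef\<close>. For
    odd \<beta> + z the range is already right.\<close>
  define R where "R = (if even (\<beta> + int z) then qint \<beta> / qint u else 1)"
  have u0: "even (\<beta> + int z) \<Longrightarrow> u > 0" using assms by (simp add: u_def)
  have "(\<Sum>j\<le>z. acoef \<beta> j * scoef0 (\<beta> + int j) (z - j)) =
      (\<Sum>w | 2 * w \<le> z. acoef \<beta> (z - 2 * w) * scoef0 (\<beta> + int (z - 2 * w)) (2 * w))"
  proof -
    have "(\<Sum>j\<le>z. acoef \<beta> j * scoef0 (\<beta> + int j) (z - j)) =
        (\<Sum>j | j \<le> z \<and> even (z - j). acoef \<beta> j * scoef0 (\<beta> + int j) (z - j))"
      by (rule sum.mono_neutral_right) (auto simp: scoef0_def simp del: even_diff_nat)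
    also have "\<dots> = (\<Sum>w | 2 * w \<le> z. acoef \<beta> (z - 2 * w) * scoef0 (\<beta> + int (z - 2 * w)) (2 * w))"
      by (rule sum.reindex_bij_witness[of _ "\<lambda>w. z - 2 * w" "\<lambda>j. (z - j) div 2"])
        (auto simp del: even_diff_nat of_nat_diff)
    finally show ?thesis .
  qed
  also have "\<dots> = (\<Sum>w | 2 * w \<le> z. R / qfact z * (hcoef z w * q powi (- (int w * (u - 1))) * (\<Prod>j<z - w. qint (u - 2 * int j))))"
  proof (rule sum.cong[OF HOL.refl])
    fix w assume "w \<in> {w. 2 * w \<le> z}"
    then have w: "2 * w \<le> z" by simp
    have par: "even (\<beta> + int (z - 2 * w)) \<longleftrightarrow> even (\<beta> + int z)"
      using w by (simp add: of_nat_diff)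
    have s: "scoef0 (\<beta> + int (z - 2 * w)) (2 * w) = q powi (- (int w * (u - 1))) * T w / evfact w"
      using w unfolding scoef0_def Let_def par by (simp add: u_def T_def of_nat_diff)
    have "acoef \<beta> (z - 2 * w) * T w * qfact (z - 2 * w) = R * (\<Prod>j<z - w. qint (u - 2 * int j))"
    proof (cases "even (\<beta> + int z)")
      case True
      then have "qint u \<noteq> 0" using u0 by simp
      then show ?thesis
        using qprod_even_split[OF w True] False True
        by (simp add: T_def R_def u_def field_simps)
    next
      case False
      then show ?thesis using qprod_odd_split[OF w False] by (simp add: T_def R_def u_def)
    qed
    then have "acoef \<beta> (z - 2 * w) * T w = R * (\<Prod>j<z - w. qint (u - 2 * int j)) / qfact (z - 2 * w)"
      by (simp add: eq_divide_eq)
    then have "acoef \<beta> (z - 2 * w) * scoef0 (\<beta> + int (z - 2 * w)) (2 * w) =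
        q powi (- (int w * (u - 1))) * (R * (\<Prod>j<z - w. qint (u - 2 * int j)) / qfact (z - 2 * w)) / evfact w"
    proof -
      have "acoef \<beta> (z - 2 * w) * (q powi (- (int w * (u - 1))) * T w / evfact w) =
          q powi (- (int w * (u - 1))) * (acoef \<beta> (z - 2 * w) * T w) / evfact w"
        by (simp only: times_divide_eq_right mult.left_commute)
      then show ?thesis
        unfolding s \<open>acoef \<beta> (z - 2 * w) * T w = _\<close> .
    qed
    then show "acoef \<beta> (z - 2 * w) * scoef0 (\<beta> + int (z - 2 * w)) (2 * w) =
        R / qfact z * (hcoef z w * q powi (- (int w * (u - 1))) * (\<Prod>j<z - w. qint (u - 2 * int j)))"
      using w by (simp add: hcoef_def)
  qed
  also have "\<dots> = R / qfact z * (\<Sum>w\<le>z. hcoef z w * q powi (- (int w * (u - 1))) * (\<Prod>j<z - w. qint (u - 2 * int j)))"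
    unfolding sum_distrib_left by (rule sum.mono_neutral_left) (auto simp: hcoef_def)
  also have "\<dots> = R / qfact z * (q powi (int z - int (tri z)) * (\<Prod>t<z. qint (u - int t)))"
    by (simp add: falling_qprod_expansion[symmetric] prod.distrib prod_powi_neg)
  also have "R * (\<Prod>t<z. qint (u - int t)) = (\<Prod>i<z. qint (\<beta> + int i))"
  proof -
    have rev: "(\<Prod>i<z. qint (v + int i)) = (\<Prod>t<z. qint (v + int z - 1 - int t))" for v
      by (subst prod.nat_diff_reindex[symmetric]) (rule prod.cong, auto simp: of_nat_diff algebra_simps)
    show ?thesis
    proof (cases "even (\<beta> + int z)")
      case True
      have "(\<Prod>t<z. qint (u - int t)) = (\<Prod>i<z. qint (\<beta> + 1 + int i))"
      proof -
        have e: "\<beta> + 1 + int z - 1 - x = \<beta> + int z - x" for x by simp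
        show ?thesis using True unfolding rev e by (simp add: u_def)
      qed
      moreover have "qint \<beta> * (\<Prod>i<z. qint (\<beta> + 1 + int i)) = (\<Prod>i<Suc z. qint (\<beta> + int i))"
        by (subst prod.lessThan_Suc_shift) (simp add: algebra_simps)
      ultimately show ?thesis using True u0 by (simp add: R_def u_def field_simps)
    next
      case False
      then show ?thesis by (simp add: R_def rev u_def)
    qed
  qed
  then have "R / qfact z * (q powi (int z - int (tri z)) * (\<Prod>t<z. qint (u - int t))) = pcoef 0 \<beta> z"
    by (simp add: pcoef_def gb_def mult_ac)
  finally show ?thesis by simp
qed simp

text \<open>Passing from (\<beta>, z + 1) to (\<beta> + j, z + 1 - j) keeps the sum, so the power of
  q in the recursion of \<open>scoef\<close> is the same for all j and equals that of
  \<open>pcoef_Suc\<close>. Hence the convolution satisfies the recursion of \<open>pcoef\<close>,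
  with outer induction on d and inner induction on z.\<close>

lemma pcoef_expansion:
  assumes "\<beta> > 0"
  shows "pcoef d \<beta> z = (\<Sum>j\<le>z. acoef \<beta> j * scoef d (\<beta> + int j) (z - j))"
proof (induction d arbitrary: z)
  case 0
  then show ?case using pcoef_expansion_0[OF assms] by simp
next
  case (Suc d)
  show ?case
  proof (induction z)
    case (Suc z)
    let ?e = "q powi (- (\<beta> + int (Suc z) + 2 * int d))"
    have "(\<Sum>j\<le>Suc z. acoef \<beta> j * scoef (Suc d) (\<beta> + int j) (Suc z - j)) =
        (\<Sum>j\<le>z. acoef \<beta> j * scoef d (\<beta> + int j) (Suc z - j) + ?e * (acoef \<beta> j * scoef (Suc d) (\<beta> + int j) (z - j)))
        + acoef \<beta> (Suc z)"
    proof -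
      have "acoef \<beta> j * scoef (Suc d) (\<beta> + int j) (Suc z - j) =
          acoef \<beta> j * scoef d (\<beta> + int j) (Suc z - j) + ?e * (acoef \<beta> j * scoef (Suc d) (\<beta> + int j) (z - j))"
        if "j \<le> z" for j
      proof -
        have "- (\<beta> + int j + int (Suc (z - j)) + 2 * int d) = - (\<beta> + int (Suc z) + 2 * int d)"
          using that by (simp add: of_nat_diff)
        then show ?thesis
          using that unfolding Suc_diff_le[OF that] scoef.simps by (simp only:) (simp add: algebra_simps)
      qed
      then show ?thesis by simp
    qed
    also have "\<dots> = (\<Sum>j\<le>Suc z. acoef \<beta> j * scoef d (\<beta> + int j) (Suc z - j)) + ?e * pcoef (Suc d) \<beta> z"
      by (simp only: Suc.IH sum.distrib sum_distrib_left sum.atMost_Suc) (simp add: add_ac)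
    also have "\<dots> = pcoef (Suc d) \<beta> (Suc z)"
      by (simp only: \<open>\<And>z. pcoef d \<beta> z = _\<close>[symmetric] pcoef_Suc)
    finally show ?case by simp
  qed simp
qed

section \<open>Alternating sums of quantum binomials and inversion of the transition\<close>

lemma qint_shift_expand:
  "qint (u + 2 * int k) = (q powi u * q powi (2 * int k) - q powi (- u) * q powi (- 2 * int k)) / (q - inverse q)"
  unfolding qint_def q_powi_add[symmetric] by simp

text \<open>The quantum binomial theorem at a root. In the induction, [j + 1] times the sum equals
  (1 - q^(e - j)) times the shorter sum at e + 1. Either e = j, or parity forces e <= j - 2 and the
  induction hypothesis applies.\<close>

lemma alternating_gauss_sum:
  assumes "\<bar>e\<bar> < int j" "even (e + int j + 1)"
  shows "(\<Sum>k\<le>j. (- 1) ^ k / (qfact k * qfact (j - k)) * q powi (int k * e)) = 0"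
  using assms
proof (induction j arbitrary: e)
  case (Suc j)
  define f where "f e = (\<Sum>k\<le>j. (- 1) ^ k / (qfact k * qfact (j - k)) * q powi (int k * e))" for e
  \<comment> \<open>Splitting [j + 1] as [(j + 1 - k) + k] cancels a factor of either factorial, so
    term k contributes to the indices k and k - 1 of the shorter sum.\<close>
  have split: "qint (int (Suc j)) * ((- 1) ^ k / (qfact k * qfact (Suc j - k)) * q powi (int k * e)) =
      (if k \<le> j then (- 1) ^ k / (qfact k * qfact (j - k)) * q powi (int k * (e + 1)) else 0)
      - (if k = 0 then 0 else q powi (e - int j) * ((- 1) ^ (k - 1) / (qfact (k - 1) * qfact (j - (k - 1))) * q powi (int (k - 1) * (e + 1))))"
    if k: "k \<le> Suc j" for k
  proof -
    have "qint (int (Suc j)) = qint (int (Suc j - k) + int k)" using k by simp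
    also have "\<dots> = q powi int k * qint (int (Suc j - k)) + q powi (- int (Suc j - k)) * qint (int k)"
      by (rule qint_add)
    finally have e1: "qint (int (Suc j)) = \<dots>" .
    have cancel: "p * n * (c / (L * (n * M)) * X) = c / (L * M) * (p * X)" if "n \<noteq> 0" for p n c L M X :: Qq
      using that by simp
    have cancel': "p * n * (c / (n * L * M) * X) = c / (L * M) * (p * X)" if "n \<noteq> 0" for p n c L M X :: Qq
      using that by simp
    have A: "q powi int k * qint (int (Suc j - k)) * ((- 1) ^ k / (qfact k * qfact (Suc j - k)) * q powi (int k * e))
        = (if k \<le> j then (- 1) ^ k / (qfact k * qfact (j - k)) * q powi (int k * (e + 1)) else 0)"
    proof (cases "k \<le> j")
      case True
      have "q powi int k * q powi (int k * e) = q powi (int k * (e + 1))"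
        unfolding q_powi_add[symmetric] by (rule arg_cong[where f = "\<lambda>x. q powi x"]) (simp add: algebra_simps)
      moreover have "qfact (Suc (j - k)) = qint (int (Suc (j - k))) * qfact (j - k)"
        by (simp add: qfact_Suc add.commute)
      ultimately show ?thesis
        using True by (simp only: Suc_diff_le if_True) (subst cancel, simp_all del: of_nat_Suc)
    next
      case False
      then show ?thesis using k by simp
    qed
    have B: "q powi (- int (Suc j - k)) * qint (int k) * ((- 1) ^ k / (qfact k * qfact (Suc j - k)) * q powi (int k * e))
        = - (if k = 0 then 0 else q powi (e - int j) * ((- 1) ^ (k - 1) / (qfact (k - 1) * qfact (j - (k - 1))) * q powi (int (k - 1) * (e + 1))))"
    proof (cases k)
      case (Suc l)
      have ex: "- int (j - l) + int (Suc l) * e = (e - int j) + int l * (e + 1)"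
        using k Suc by (simp add: of_nat_diff algebra_simps)
      have X: "q powi (- int (j - l)) * q powi (int (Suc l) * e) = q powi (e - int j) * q powi (int l * (e + 1))"
        unfolding q_powi_add[symmetric] ex ..
      have "qfact (Suc l) = qint (int (Suc l)) * qfact l"
        by (simp add: qfact_Suc add.commute)
      then have "q powi (- int (j - l)) * qint (int (Suc l)) * ((- 1) ^ Suc l / (qfact (Suc l) * qfact (j - l)) * q powi (int (Suc l) * e))
          = (- 1) ^ Suc l / (qfact l * qfact (j - l)) * (q powi (e - int j) * q powi (int l * (e + 1)))"
        unfolding X[symmetric] by (simp only:, subst cancel') (simp_all del: of_nat_Suc)
      then show ?thesis
        unfolding Suc by simp
    qed simp
    show ?thesis
      unfolding e1 semiring_class.distrib_right A B diff_conv_add_uminus by (rule HOL.refl)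
  qed
  have "qint (int (Suc j)) * (\<Sum>k\<le>Suc j. (- 1) ^ k / (qfact k * qfact (Suc j - k)) * q powi (int k * e)) =
      (\<Sum>k\<le>Suc j. (if k \<le> j then (- 1) ^ k / (qfact k * qfact (j - k)) * q powi (int k * (e + 1)) else 0))
      - (\<Sum>k\<le>Suc j. if k = 0 then 0 else q powi (e - int j) * ((- 1) ^ (k - 1) / (qfact (k - 1) * qfact (j - (k - 1))) * q powi (int (k - 1) * (e + 1))))"
    unfolding sum_distrib_left sum_subtractf[symmetric] by (rule sum.cong) (simp_all only: split atMost_iff)
  also have "\<dots> = f (e + 1) - q powi (e - int j) * f (e + 1)"
    by (subst (2) sum.atMost_Suc_shift) (simp add: f_def sum_distrib_left)
  also have "\<dots> = 0"
  proof (cases "e = int j")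
    case False
    have "e \<noteq> int j - 1" using Suc.prems by auto
    then have "f (e + 1) = 0"
      unfolding f_def using Suc.prems False by (intro Suc.IH) auto
    then show ?thesis by simp
  qed simp
  finally show ?case by (simp del: of_nat_Suc)
qed simp

text \<open>Each factor [u + 2k + 2h] is a combination of q^(2k) and q^(-2k), so removing it moves e
  by 2 up or down. The bound on e leaves room for h such moves.\<close>

lemma alternating_qprod_sum:
  assumes "\<bar>e\<bar> + 2 * int h < int j" "even (e + int j + 1)"
  shows "(\<Sum>k\<le>j. (- 1) ^ k / (qfact k * qfact (j - k)) * (q powi (int k * e) * qprod (u + 2 * int k) h)) = 0"
  using assms
proof (induction h arbitrary: e)
  case 0
  then show ?case using alternating_gauss_sum[of e j] by simp
next
  case (Suc h)
  define g where "g e = (\<Sum>k\<le>j. (- 1) ^ k / (qfact k * qfact (j - k)) * (q powi (int k * e) * qprod (u + 2 * int k) h))" for e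
  define v where "v = u + 2 * int h"
  have H: "q powi (int k * e) * qprod (u + 2 * int k) (Suc h) =
      (q powi v * (q powi (int k * (e + 2)) * qprod (u + 2 * int k) h)
       - q powi (- v) * (q powi (int k * (e - 2)) * qprod (u + 2 * int k) h)) / (q - inverse q)" for k
  proof -
    have e1: "q powi (int k * (e + 2)) = q powi (int k * e) * q powi (2 * int k)"
      unfolding q_powi_add[symmetric] by (rule arg_cong[where f = "\<lambda>x. q powi x"]) (simp add: algebra_simps)
    have e2: "q powi (int k * (e - 2)) = q powi (int k * e) * q powi (- 2 * int k)"
      unfolding q_powi_add[symmetric] by (rule arg_cong[where f = "\<lambda>x. q powi x"]) (simp add: algebra_simps)
    have e3: "u + 2 * int k + 2 * int h = v + 2 * int k" by (simp add: v_def)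
    show ?thesis unfolding e1 e2 qprod_Suc e3 qint_shift_expand by (simp add: algebra_simps diff_divide_distrib)
  qed
  have "c * ((A * X - B * Y) / D) = (A * (c * X) - B * (c * Y)) / D" for c A X B Y D :: Qq
    by (simp add: algebra_simps diff_divide_distrib)
  then have "(\<Sum>k\<le>j. (- 1) ^ k / (qfact k * qfact (j - k)) * (q powi (int k * e) * qprod (u + 2 * int k) (Suc h))) =
      (q powi v * g (e + 2) - q powi (- v) * g (e - 2)) / (q - inverse q)"
    unfolding H g_def sum_distrib_left sum_subtractf[symmetric] sum_divide_distrib
    by (intro sum.cong HOL.refl)
  moreover have "g (e + 2) = 0"
  proof -
    have "\<bar>e + 2\<bar> + 2 * int h < int j" "even (e + 2 + int j + 1)"
      using Suc.prems by simp_all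
    then show ?thesis unfolding g_def by (rule Suc.IH)
  qed
  moreover have "g (e - 2) = 0"
  proof -
    have "\<bar>e - 2\<bar> + 2 * int h < int j" "even (e - 2 + int j + 1)"
      using Suc.prems by simp_all
    then show ?thesis unfolding g_def by (rule Suc.IH)
  qed
  ultimately show ?case by simp
qed

definition bcoef :: "int \<Rightarrow> nat \<Rightarrow> Qq" where
  "bcoef \<beta> k = (- 1) ^ k * (qprod \<beta> k / qfact k)"

text \<open>In units of 2 above \<beta>, the runs [0, k) and [k - h, l) on the left become [0, l)
  and [k - h, k) on the right: the two runs exchange their right endpoints.\<close>

lemma qprod_interleave:
  assumes "k \<le> l + h"
  shows "qprod \<beta> k * qprod (\<beta> + 2 * (int k - int h)) (l + h - k) = qprod \<beta> l * qprod (\<beta> + 2 * (int k - int h)) h"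
proof (cases "k \<le> l")
  case True
  have "qprod (\<beta> + 2 * (int k - int h)) (l + h - k) =
      qprod (\<beta> + 2 * (int k - int h)) h * qprod (\<beta> + 2 * int k) (l - k)"
    using qprod_add[of "\<beta> + 2 * (int k - int h)" h "l - k"] True by (simp add: algebra_simps)
  moreover have "qprod \<beta> l = qprod \<beta> k * qprod (\<beta> + 2 * int k) (l - k)"
    using qprod_add[of \<beta> k "l - k"] True by simp
  ultimately show ?thesis by simp
next
  case False
  have "qprod (\<beta> + 2 * (int k - int h)) h =
      qprod (\<beta> + 2 * (int k - int h)) (l + h - k) * qprod (\<beta> + 2 * int l) (k - l)"
    using qprod_add[of "\<beta> + 2 * (int k - int h)" "l + h - k" "k - l"] False assms
    by (simp add: of_nat_diff algebra_simps)
  moreover have "qprod \<beta> k = qprod \<beta> l * qprod (\<beta> + 2 * int l) (k - l)"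
    using qprod_add[of \<beta> l "k - l"] False by simp
  ultimately show ?thesis by simp
qed

text \<open>As \<beta> + k + (j - k) has the parity of j, all terms use the same kind of
  coefficient. By \<open>qprod_interleave\<close> a product independent of k leaves the sum, and
  only h factors still depend on k, few enough for \<open>alternating_qprod_sum\<close>.\<close>

lemma bcoef_acoef_inverse:
  assumes "even \<beta>" "j > 0"
  shows "(\<Sum>k\<le>j. bcoef \<beta> k * acoef (\<beta> + int k) (j - k)) = 0"
proof (cases "even j")
  case False
  then obtain h where j: "j = 2 * h + 1" by (metis oddE)
  have "bcoef \<beta> k * acoef (\<beta> + int k) (j - k) =
      qprod \<beta> (h + 1) * ((- 1) ^ k / (qfact k * qfact (j - k)) * (q powi (int k * 0) * qprod (\<beta> - 2 * int h + 2 * int k) h))"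
    if "k \<le> j" for k
  proof -
    have "odd (\<beta> + int k + int (j - k))" using that assms False by (auto simp: of_nat_diff)
    then have "acoef (\<beta> + int k) (j - k) = odd_coeff (\<beta> + int k) (j - k)"
      unfolding acoef_def by (rule if_not_P)
    moreover have "\<beta> + int k - int (j - k) + 1 = \<beta> + 2 * (int k - int h)"
      using that by (simp add: j of_nat_diff)
    moreover have jk: "j - k = h + 1 + h - k" by (simp add: j)
    ultimately have a: "acoef (\<beta> + int k) (j - k) = qprod (\<beta> + 2 * (int k - int h)) (h + 1 + h - k) / qfact (j - k)"
      by (simp only: odd_coeff_def)
    have "qprod \<beta> k * qprod (\<beta> + 2 * (int k - int h)) (h + 1 + h - k) =
        qprod \<beta> (h + 1) * qprod (\<beta> + 2 * (int k - int h)) h"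
      by (rule qprod_interleave) (use that j in auto)
    moreover have "\<beta> + 2 * (int k - int h) = \<beta> - 2 * int h + 2 * int k" by simp
    ultimately show ?thesis unfolding a bcoef_def by (simp add: field_simps)
  qed
  then have "(\<Sum>k\<le>j. bcoef \<beta> k * acoef (\<beta> + int k) (j - k)) = qprod \<beta> (h + 1) *
      (\<Sum>k\<le>j. (- 1) ^ k / (qfact k * qfact (j - k)) * (q powi (int k * 0) * qprod (\<beta> - 2 * int h + 2 * int k) h))"
    unfolding sum_distrib_left by (intro sum.cong) auto
  also have "\<dots> = 0"
    using False j alternating_qprod_sum[of 0 h j "\<beta> - 2 * int h"] by simp
  finally show ?thesis .
next
  case True
  then obtain i where "j = 2 * i" by (rule evenE)
  then obtain h where j: "j = 2 * Suc h" using assms(2) by (cases i) auto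
  define v where "v = \<beta> - 2 * int h"
  have "bcoef \<beta> k * acoef (\<beta> + int k) (j - k) =
      qprod \<beta> (Suc h) * ((- 1) ^ k / (qfact k * qfact (j - k)) * (qint (\<beta> + int k) * qprod (v + 2 * int k) h))"
    if "k \<le> j" for k
  proof (cases "k = j")
    \<comment> \<open>The convention that the even coefficient at 0 is 1 makes k = j a separate
      case.\<close>
    case True
    have jj: "j = Suc h + Suc h" and e: "\<beta> + 2 * int (Suc h) = \<beta> + int j" "\<beta> + int j + 2 = v + 2 * int j"
      by (simp_all add: j v_def)
    have "qprod \<beta> (Suc h + Suc h) = qprod \<beta> (Suc h) * (qint (\<beta> + int j) * qprod (v + 2 * int j) h)"
      by (simp only: qprod_add qprod_Suc'[of "\<beta> + int j" h] e)
    then have "qprod \<beta> j = qprod \<beta> (Suc h) * (qint (\<beta> + int j) * qprod (v + 2 * int j) h)"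
      by (simp only: jj[symmetric])
    then show ?thesis using True by (simp add: bcoef_def)
  next
    case False
    have "even (\<beta> + int k + int (j - k))" using that assms \<open>even j\<close> by (auto simp: of_nat_diff)
    then have "acoef (\<beta> + int k) (j - k) = even_coeff (\<beta> + int k) (j - k)"
      unfolding acoef_def by (rule if_P)
    also have "\<dots> = qint (\<beta> + int k) * (qprod (\<beta> + int k - int (j - k) + 2) (j - k - 1) / qfact (j - k))"
      unfolding even_coeff_def by (rule if_not_P) (use that False in simp)
    finally have "acoef (\<beta> + int k) (j - k) = \<dots>" .
    moreover have "\<beta> + int k - int (j - k) + 2 = \<beta> + 2 * (int k - int h)"
      using that by (simp add: j of_nat_diff)
    moreover have "j - k - 1 = Suc h + h - k" by (simp add: j)
    ultimately have a: "acoef (\<beta> + int k) (j - k) =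
        qint (\<beta> + int k) * (qprod (\<beta> + 2 * (int k - int h)) (Suc h + h - k) / qfact (j - k))"
      by (simp only:)
    have e: "qprod \<beta> k * qprod (\<beta> + 2 * (int k - int h)) (Suc h + h - k) =
        qprod \<beta> (Suc h) * qprod (\<beta> + 2 * (int k - int h)) h"
      by (rule qprod_interleave) (use that False j in auto)
    have v: "\<beta> + 2 * (int k - int h) = v + 2 * int k" by (simp add: v_def)
    have rearrange: "c * (X / Q) * (b * (Y / R)) = (X * Y) * (c / (Q * R) * b)" for c X Q b Y R :: Qq
      by simp
    show ?thesis unfolding a bcoef_def rearrange e unfolding v by (simp only: mult_ac)
  qed
  \<comment> \<open>Expanding [\<beta> + k] in powers of q yields two alternating sums, with e = 1
    and e = - 1.\<close>
  moreover have "c * (qint (\<beta> + int k) * x) =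
      (q powi \<beta> * (c * (q powi (int k * 1) * x)) - q powi (- \<beta>) * (c * (q powi (int k * (- 1)) * x))) / (q - inverse q)" for k c x
    by (simp add: qint_def q_powi_add q_powi_diff power_int_minus divide_inverse algebra_simps)
  ultimately have "(\<Sum>k\<le>j. bcoef \<beta> k * acoef (\<beta> + int k) (j - k)) = qprod \<beta> (Suc h) *
     ((q powi \<beta> * (\<Sum>k\<le>j. (- 1) ^ k / (qfact k * qfact (j - k)) * (q powi (int k * 1) * qprod (v + 2 * int k) h))
      - q powi (- \<beta>) * (\<Sum>k\<le>j. (- 1) ^ k / (qfact k * qfact (j - k)) * (q powi (int k * (- 1)) * qprod (v + 2 * int k) h)))
       / (q - inverse q))"
    unfolding sum_distrib_left sum_subtractf[symmetric] sum_divide_distrib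
    by (intro sum.cong HOL.refl) (simp only: atMost_iff)
  also have "\<dots> = 0"
    using alternating_qprod_sum[of 1 h j v] alternating_qprod_sum[of "- 1" h j v] j by simp
  finally show ?thesis .
qed

text \<open>Expand each \<open>pcoef\<close> by \<open>pcoef_expansion\<close> and collect by the
  total shift j = k + i; \<open>bcoef_acoef_inverse\<close> removes every j > 0.\<close>

lemma scoef_eq_pcoef_sum:
  assumes "\<beta> > 0" "even \<beta>"
  shows "scoef d \<beta> z = (\<Sum>k\<le>z. bcoef \<beta> k * pcoef d (\<beta> + int k) (z - k))"
proof -
  have "(\<Sum>k\<le>z. bcoef \<beta> k * pcoef d (\<beta> + int k) (z - k)) =
      (\<Sum>k\<le>z. \<Sum>i\<le>z - k. bcoef \<beta> k * acoef (\<beta> + int k) i * scoef d (\<beta> + int (k + i)) (z - (k + i)))"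
  proof (rule sum.cong[OF HOL.refl])
    fix k
    have "pcoef d (\<beta> + int k) (z - k) =
        (\<Sum>j\<le>z - k. acoef (\<beta> + int k) j * scoef d (\<beta> + int k + int j) (z - k - j))"
      by (rule pcoef_expansion) (use assms in simp)
    then show "bcoef \<beta> k * pcoef d (\<beta> + int k) (z - k) =
      (\<Sum>i\<le>z - k. bcoef \<beta> k * acoef (\<beta> + int k) i * scoef d (\<beta> + int (k + i)) (z - (k + i)))"
      by (simp add: sum_distrib_left mult.assoc add.assoc)
  qed
  also have "\<dots> = (\<Sum>(k, i)\<in>{(k, i). k + i \<le> z}. bcoef \<beta> k * acoef (\<beta> + int k) i * scoef d (\<beta> + int (k + i)) (z - (k + i)))"
    by (subst sum.Sigma) (auto intro!: sum.cong)
  also have "\<dots> = (\<Sum>j\<le>z. \<Sum>k\<le>j. bcoef \<beta> k * acoef (\<beta> + int k) (j - k) * scoef d (\<beta> + int j) (z - j))"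
    unfolding sum.triangle_reindex_eq by (intro sum.cong HOL.refl) simp
  also have "\<dots> = (\<Sum>j\<le>z. (if j = 0 then scoef d \<beta> z else 0))"
  proof (rule sum.cong[OF HOL.refl])
    fix j
    show "(\<Sum>k\<le>j. bcoef \<beta> k * acoef (\<beta> + int k) (j - k) * scoef d (\<beta> + int j) (z - j)) =
        (if j = 0 then scoef d \<beta> z else 0)"
    proof (cases "j = 0")
      case False
      then show ?thesis
        using bcoef_acoef_inverse[OF assms(2), of j] unfolding sum_distrib_right[symmetric] by simp
    qed (simp add: bcoef_def)
  qed
  also have "\<dots> = scoef d \<beta> z" by simp
  finally show ?thesis by simp
qed

section \<open>Relations in U and modules generated from a highest weight vector\<close>

section \<open>Highest weight modules\<close>

lemma scal_add: "scal (c + d) = scal c + scal d"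
  by transfer (rule urel.scal_add)

lemma scal_mult: "scal (c * d) = scal c * scal d"
  by transfer (rule urel.scal_mul)

lemma scal_0: "scal 0 = 0"
  by transfer (rule urel.refl)

lemma scal_1: "scal 1 = 1"
  by transfer (rule urel.refl)

lemma scal_central: "scal c * x = x * scal c"
  by transfer (rule urel.scal_central)

lemma Uq_K_F: "K i * F j * Kinv i = scal (q powi (- cartan i j)) * F j"
  by transfer (rule urel.K_F)

lemma K_F: "K i * F j = scal (q powi (- cartan i j)) * F j * K i"
  by (metis Uq_K_F Kinv_K mult.assoc mult.right_neutral)

lemma E_F_same: "E i * F i = F i * E i + scal (inverse (q - inverse q)) * (K i - Kinv i)"
proof -
  have "E i * F i - F i * E i = scal (inverse (q - inverse q)) * (K i - Kinv i)"
    by transfer (rule urel.E_F_same)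
  then show ?thesis by (simp add: algebra_simps)
qed

lemma E_F_diff: "i \<noteq> j \<Longrightarrow> E i * F j = F j * E i"
proof -
  assume "i \<noteq> j"
  then have "E i * F j - F j * E i = 0"
    by transfer (rule urel.E_F_diff)
  then show ?thesis by simp
qed

lemma dpow_neg [simp]: "r < 0 \<Longrightarrow> dpow x r = 0"
  by (simp add: dpow_def)

lemma dpow_0 [simp]: "dpow x 0 = 1"
  by (simp add: dpow_def scal_1)

lemma dpow_of_nat: "dpow x (int r) = scal (inverse (qfact r)) * x ^ r"
  by (simp add: dpow_def)

text \<open>At \<open>r = - 1\<close> the scalar is [0], which matches the zero divided power. The
  rule thus holds for all integers, and boundary terms take care of themselves.\<close>

lemma mult_dpow: "x * dpow x r = scal (qint (r + 1)) * dpow x (r + 1)"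
proof -
  consider "r < - 1" | "r = - 1" | "r \<ge> 0" by linarith
  then show ?thesis
  proof cases
    case 3
    then obtain k where r: "r = int k" by (metis nonneg_int_cases)
    have "x * dpow x (int k) = scal (inverse (qfact k)) * x ^ Suc k"
      unfolding dpow_of_nat by (metis mult.assoc power_Suc scal_central)
    also have "inverse (qfact k) = qint (int k + 1) * inverse (qfact (Suc k))"
      by (simp add: qfact_Suc)
    also have "scal \<dots> * x ^ Suc k = scal (qint (int k + 1)) * dpow x (int (Suc k))"
      unfolding dpow_of_nat by (simp only: scal_mult mult.assoc)
    finally show ?thesis by (simp add: r add.commute)
  qed (simp_all add: scal_0)
qed

locale hw_module =
  fixes act :: "Uq \<Rightarrow> 'v \<Rightarrow> 'v::ab_group_add"
    and m n :: nat
    and \<eta> :: 'v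
  assumes module: "is_module act"
    and hw: "is_highest_weight_vector act m n \<eta>"
begin

abbreviation sc :: "Qq \<Rightarrow> 'v \<Rightarrow> 'v" where
  "sc c v \<equiv> act (scal c) v"

lemma act_add: "act x (v + w) = act x v + act x w"
  and act_plus: "act (x + y) v = act x v + act y v"
  and act_mult: "act (x * y) v = act x (act y v)"
  and act_1 [simp]: "act 1 v = v"
  using module by (simp_all add: is_module_def)

sublocale vector_space sc
  by unfold_locales (simp_all add: act_add act_plus scal_add scal_mult act_mult scal_1)

lemma act_0 [simp]: "act x 0 = 0"
  using act_add[of x 0 0] by simp

lemma act_zero [simp]: "act 0 v = 0"
  using act_plus[of 0 0 v] by simp

lemma act_uminus: "act (- x) v = - act x v"
  using act_plus[of x "- x" v] by (simp add: add_eq_0_iff)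

lemma act_diff_left: "act (x - y) v = act x v - act y v"
  using act_plus[of x "- y" v] by (simp add: act_uminus)

lemma act_sc: "act x (sc c v) = sc c (act x v)"
  by (metis act_mult scal_central)

lemmas act_scs = act_sc[where x = "E i" for i] act_sc[where x = "F i" for i]
  act_sc[where x = "K i" for i] act_sc[where x = "Kinv i" for i]
  act_sc[where x = "dpow y r" for y r] act_sc[where x = "y ^ r" for y and r :: nat]

lemma act_sum: "act x (sum f A) = (\<Sum>i\<in>A. act x (f i))"
  by (induction A rule: infinite_finite_induct) (simp_all add: act_add)

lemma \<eta>_nz: "\<eta> \<noteq> 0"
  and E_\<eta> [simp]: "act (E i) \<eta> = 0"
  using hw by (simp_all add: is_highest_weight_vector_def)

section \<open>Weight vectors and commutation of E with divided powers of F\<close>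

definition wt :: "(idx \<Rightarrow> int) \<Rightarrow> 'v \<Rightarrow> bool" where
  "wt \<mu> v \<longleftrightarrow> (\<forall>i. act (K i) v = sc (q powi \<mu> i) v)"

lemma wt_0 [simp]: "wt \<mu> 0"
  by (simp add: wt_def)

lemma wt_sc: "wt \<mu> v \<Longrightarrow> wt \<mu> (sc c v)"
  by (simp add: wt_def act_scs mult.commute)

lemma wt_K: "wt \<mu> v \<Longrightarrow> act (K i) v = sc (q powi \<mu> i) v"
  by (simp add: wt_def)

lemma wt_Kinv:
  assumes "wt \<mu> v"
  shows "act (Kinv i) v = sc (q powi (- \<mu> i)) v"
proof -
  have "v = act (Kinv i) (act (K i) v)"
    by (simp add: Kinv_K flip: act_mult)
  also have "\<dots> = sc (q powi \<mu> i) (act (Kinv i) v)"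
    by (simp add: wt_K[OF assms] act_scs)
  finally have "sc (q powi (- \<mu> i)) v = sc (q powi (- \<mu> i)) (sc (q powi \<mu> i) (act (Kinv i) v))"
    by simp
  then show ?thesis by (simp add: power_int_minus)
qed

lemma wt_F:
  assumes "wt \<mu> v"
  shows "wt (\<lambda>i. \<mu> i - cartan i j) (act (F j) v)"
  unfolding wt_def
proof
  fix i
  have "act (K i) (act (F j) v) = sc (q powi (- cartan i j)) (act (F j) (act (K i) v))"
    by (simp only: K_F act_mult[symmetric] mult.assoc)
  then show "act (K i) (act (F j) v) = sc (q powi (\<mu> i - cartan i j)) (act (F j) v)"
    by (simp add: wt_K[OF assms] act_scs q_powi_add[symmetric] algebra_simps)
qed

lemma wt_F_power: "wt \<mu> v \<Longrightarrow> wt (\<lambda>i. \<mu> i - int r * cartan i j) (act (F j ^ r) v)"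
proof (induction r)
  case (Suc r)
  from wt_F[OF Suc.IH[OF Suc.prems], of j] show ?case
    by (simp add: act_mult algebra_simps)
qed simp

lemma wt_dpow_F:
  assumes "wt \<mu> v"
  shows "wt (\<lambda>i. \<mu> i - r * cartan i j) (act (dpow (F j) r) v)"
proof (cases "r < 0")
  case False
  then show ?thesis
    using wt_sc[OF wt_F_power[OF assms, of "nat r" j]] by (simp add: dpow_def act_mult)
qed simp

lemma wt_\<eta>: "wt (\<lambda>i. case i of I1 \<Rightarrow> int m | I2 \<Rightarrow> int n) \<eta>"
  using hw by (auto simp: wt_def is_highest_weight_vector_def split: idx.split)

lemma act_mult_dpow: "act x (act (dpow x r) v) = sc (qint (r + 1)) (act (dpow x (r + 1)) v)"
  using mult_dpow[of x r] by (simp flip: act_mult)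

lemma E_dpow_F_diff:
  assumes "i \<noteq> j"
  shows "act (E i) (act (dpow (F j) r) v) = act (dpow (F j) r) (act (E i) v)"
proof -
  have "E i * F j ^ k = F j ^ k * E i" for k
  proof (induction k)
    case (Suc k)
    have "E i * F j ^ Suc k = (E i * F j) * F j ^ k" by (simp only: power_Suc mult.assoc)
    also have "\<dots> = F j * (E i * F j ^ k)" by (simp only: E_F_diff[OF assms] mult.assoc)
    finally show ?case by (simp only: Suc.IH power_Suc mult.assoc)
  qed simp
  then have "act (E i) (act (F j ^ k) v) = act (F j ^ k) (act (E i) v)" for k
    by (metis act_mult)
  then show ?thesis by (simp add: dpow_def act_mult act_scs)
qed

text \<open>The rank one commutator formula, by induction on r: on a weight vector K acts by a
  scalar, and the two resulting scalars combine through \<open>qint_three\<close>.\<close>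

lemma E_dpow_F_same:
  assumes "wt \<mu> v"
  shows "act (E i) (act (dpow (F i) r) v) =
    act (dpow (F i) r) (act (E i) v) + sc (qint (\<mu> i - r + 1)) (act (dpow (F i) (r - 1)) v)"
proof (cases "r < 0")
  case False
  have "act (E i) (act (dpow (F i) (int k)) v) =
    act (dpow (F i) (int k)) (act (E i) v) + sc (qint (\<mu> i - int k + 1)) (act (dpow (F i) (int k - 1)) v)" for k
  proof (induction k)
    case (Suc k)
    define D where "D r = act (dpow (F i) r)" for r
    have FD: "act (F i) (D r w) = sc (qint (r + 1)) (D (r + 1) w)" for r w
      by (simp add: D_def act_mult_dpow)
    define w where "w = D (int k) v"
    have wtw: "wt (\<lambda>i'. \<mu> i' - int k * cartan i' i) w"
      unfolding w_def D_def by (rule wt_dpow_F[OF assms])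
    have EF: "act (E i) (act (F i) w) = act (F i) (act (E i) w) + sc (qint (\<mu> i - 2 * int k)) w"
    proof -
      have "act (E i) (act (F i) w) = act (F i) (act (E i) w)
          + sc (inverse (q - inverse q)) (act (K i) w - act (Kinv i) w)"
        by (simp only: act_mult[symmetric] E_F_same act_plus act_diff_left[symmetric])
      also have "act (K i) w - act (Kinv i) w =
          sc (q powi (\<mu> i - 2 * int k) - q powi (- (\<mu> i - 2 * int k))) w"
        using wt_K[OF wtw, of i] wt_Kinv[OF wtw, of i] by (simp add: cartan_def scale_left_diff_distrib mult.commute)
      finally show ?thesis
        by (simp add: qint_def divide_inverse mult.commute)
    qed
    have IH: "act (E i) w = D (int k) (act (E i) v) + sc (qint (\<mu> i - int k + 1)) (D (int k - 1) v)"
      using Suc by (simp add: w_def D_def)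
    have "sc (qint (int k + 1)) (act (E i) (D (int k + 1) v)) = act (E i) (act (F i) w)"
      by (simp add: w_def FD act_scs)
    also have "\<dots> = sc (qint (int k + 1)) (D (int k + 1) (act (E i) v))
        + sc (qint (\<mu> i - int k + 1) * qint (int k) + qint (\<mu> i - 2 * int k)) w"
      unfolding EF IH by (simp add: act_add act_scs FD w_def scale_left_distrib)
    also have "qint (\<mu> i - int k + 1) * qint (int k) + qint (\<mu> i - 2 * int k)
        = qint (int k + 1) * qint (\<mu> i - int k)"
    proof -
      have e: "\<mu> i - int k - int k = \<mu> i - 2 * int k" by simp
      show ?thesis
        using qint_three[of 1 "int k" "\<mu> i - int k"] unfolding e
        by (simp add: add.commute[of 1] mult.commute)
    qed
    also have "sc (qint (int k + 1)) (D (int k + 1) (act (E i) v)) + sc (qint (int k + 1) * qint (\<mu> i - int k)) w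
        = sc (qint (int k + 1)) (D (int k + 1) (act (E i) v) + sc (qint (\<mu> i - int k)) w)"
      by (simp add: scale_right_distrib)
    finally have "act (E i) (D (int k + 1) v) = D (int k + 1) (act (E i) v) + sc (qint (\<mu> i - int k)) w"
      by (simp add: scale_cancel_left)
    then show ?case by (simp add: D_def w_def add.commute)
  qed simp
  then show ?thesis using False by (metis nonneg_int_cases not_less)
qed simp

section \<open>Action of the generators of U and of the coideal subalgebra on the monomials\<close>

abbreviation Fm :: "int \<Rightarrow> int \<Rightarrow> int \<Rightarrow> 'v" where
  "Fm \<equiv> Fmon act \<eta>"

lemma Fm_eq: "Fm a b c = act (dpow (F I1) a) (act (dpow (F I2) b) (act (dpow (F I1) c) \<eta>))"
  by (simp add: Fmon_def act_mult)

lemma Fm_neg: "a < 0 \<or> b < 0 \<or> c < 0 \<Longrightarrow> Fm a b c = 0"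
  by (auto simp: Fm_eq)

lemma wt_Fm:
  "wt (\<lambda>i. case i of I1 \<Rightarrow> int m - 2 * c + b - 2 * a | I2 \<Rightarrow> int n + c - 2 * b + a) (Fm a b c)"
proof -
  have "(\<lambda>i. (case i of I1 \<Rightarrow> int m | I2 \<Rightarrow> int n) - c * cartan i I1 - b * cartan i I2 - a * cartan i I1)
     = (\<lambda>i. case i of I1 \<Rightarrow> int m - 2 * c + b - 2 * a | I2 \<Rightarrow> int n + c - 2 * b + a)"
    by (auto simp: fun_eq_iff cartan_def split: idx.split)
  then show ?thesis
    unfolding Fm_eq using wt_dpow_F[OF wt_dpow_F[OF wt_dpow_F[OF wt_\<eta>, where r = c and j = I1],
      where r = b and j = I2], where r = a and j = I1] by simp
qed

lemma F1_Fm: "act (F I1) (Fm a b c) = sc (qint (a + 1)) (Fm (a + 1) b c)"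
  by (simp add: Fm_eq act_mult_dpow)

lemma F2_Fm: "act (F I2) (Fm 0 b c) = sc (qint (b + 1)) (Fm 0 (b + 1) c)"
  by (simp add: Fm_eq act_mult_dpow)

text \<open>E_1 passes F_2 and meets the two outer divided powers of F_1, which gives two
  terms.\<close>

lemma E1_Fm:
  "act (E I1) (Fm a b c) = sc (qint (int m - c + 1)) (Fm a b (c - 1))
     + sc (qint (int m - 2 * c + b - a + 1)) (Fm (a - 1) b c)"
proof -
  define v where "v = act (dpow (F I2) b) (act (dpow (F I1) c) \<eta>)"
  have "wt (\<lambda>i. case i of I1 \<Rightarrow> int m - 2 * c + b | I2 \<Rightarrow> int n + c - 2 * b) v"
    using wt_Fm[where a = 0 and b = b and c = c] by (simp add: Fm_eq v_def cong: idx.case_cong)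
  note * = E_dpow_F_same[OF this, of I1 a]
  have "act (E I1) (act (dpow (F I1) c) \<eta>) = sc (qint (int m - c + 1)) (act (dpow (F I1) (c - 1)) \<eta>)"
    using E_dpow_F_same[OF wt_\<eta>, of I1 c] by simp
  then have "act (E I1) v = sc (qint (int m - c + 1)) (act (dpow (F I2) b) (act (dpow (F I1) (c - 1)) \<eta>))"
    by (simp add: v_def E_dpow_F_diff act_scs)
  with * show ?thesis
    by (simp add: Fm_eq v_def[symmetric] act_scs)
qed

lemma E2_Fm: "act (E I2) (Fm a b c) = sc (qint (int n + c - b + 1)) (Fm a (b - 1) c)"
proof -
  have "wt (\<lambda>i. case i of I1 \<Rightarrow> int m - 2 * c | I2 \<Rightarrow> int n + c) (act (dpow (F I1) c) \<eta>)"
    using wt_Fm[where a = 0 and b = 0 and c = c] by (simp add: Fm_eq cong: idx.case_cong)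
  from E_dpow_F_same[OF this, of I2 b] show ?thesis
    by (simp add: Fm_eq E_dpow_F_diff act_scs)
qed

lemma B_act: "act (B \<sigma> i) v = act (F i) v + sc (q powi \<sigma> i) (act (E (tau i)) (act (Kinv i) v))"
  by (simp add: B_def act_plus act_mult)

lemma q_powi_mult: "x + y = z \<Longrightarrow> q powi x * (q powi y * f) = q powi z * f"
  by (auto simp: q_powi_add)

lemma B1_Fm: "act (B \<sigma> I1) (Fm a b c) = sc (qint (a + 1)) (Fm (a + 1) b c)
    + sc (q powi (\<sigma> I1 - int m + 2 * c - b + 2 * a) * qint (int n + c - b + 1)) (Fm a (b - 1) c)"
proof -
  have "act (B \<sigma> I1) (Fm a b c) = sc (qint (a + 1)) (Fm (a + 1) b c)
      + sc (q powi \<sigma> I1 * (q powi (- (int m - 2 * c + b - 2 * a)) * qint (int n + c - b + 1))) (Fm a (b - 1) c)"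
    by (simp only: B_act F1_Fm wt_Kinv[OF wt_Fm] tau.simps act_scs E2_Fm scale_scale idx.case)
  then show ?thesis by (subst (asm) q_powi_mult[OF HOL.refl]) (simp add: algebra_simps)
qed

text \<open>In \<open>Bmon\<close> the powers of B_2 act before the outer power of B_1, on monomials
  with a = 0. There the second term of \<open>E1_Fm\<close> has a negative exponent and
  vanishes.\<close>

lemma B2_Fm: "act (B \<sigma> I2) (Fm 0 b c) = sc (qint (b + 1)) (Fm 0 (b + 1) c)
    + sc (q powi (\<sigma> I2 - int n - c + 2 * b) * qint (int m - c + 1)) (Fm 0 b (c - 1))"
proof -
  have "act (B \<sigma> I2) (Fm 0 b c) = sc (qint (b + 1)) (Fm 0 (b + 1) c)
      + sc (q powi \<sigma> I2 * (q powi (- (int n + c - 2 * b + 0)) * qint (int m - c + 1))) (Fm 0 b (c - 1))"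
    by (simp only: B_act F2_Fm wt_Kinv[OF wt_Fm] tau.simps act_scs E1_Fm scale_scale idx.case) (simp add: Fm_neg)
  then show ?thesis by (subst (asm) q_powi_mult[OF HOL.refl]) (simp add: algebra_simps)
qed

text \<open>An abstract two-term rule covering both generators: k is the exponent being raised and x
  counts the uses of the lowering summand. The weights of all orders in which the two summands can
  act add up to a power of q times a quantum binomial.\<close>

lemma dpow_expansion:
  assumes "\<And>k x. act t (g k x) = sc (qint (int k + 1)) (g (Suc k) x)
      + sc (q powi (L + 2 * int k + int x) * qint (N + int x + 1)) (g k (Suc x))"
  shows "act (dpow t (int a)) (g 0 0) =
    (\<Sum>x\<le>a. sc (q powi (int x * (L + int a) - int (tri x)) * gb N x) (g (a - x) x))"
proof (induction a)
  case (Suc a)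
  define P where "P a x = q powi (int x * (L + int a) - int (tri x)) * gb N x" for a x :: nat
  have P1: "P (Suc a) x = q powi int x * P a x" for x
    unfolding P_def mult.assoc[symmetric] q_powi_add[symmetric]
    by (rule arg_cong[where f = "\<lambda>e. q powi e * gb N x"]) (simp add: algebra_simps)
  have P2: "P a x * (q powi (L + 2 * int (a - x) + int x) * qint (N + int x + 1)) =
      q powi (int a + 1) * (qint (int (Suc x)) * P a (Suc x))" if "x \<le> a" for x
  proof -
    have "P a x * (q powi (L + 2 * int (a - x) + int x) * qint (N + int x + 1)) =
        (q powi (int x * (L + int a) - int (tri x)) * q powi (L + 2 * int (a - x) + int x))
        * (qint (N + 1 + int x) * gb N x)"
      by (simp add: P_def ac_simps)
    also have "\<dots> = (q powi (int x * (L + int a) - int (tri x)) * q powi (L + 2 * int (a - x) + int x))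
        * (qint (int x + 1) * gb N (Suc x))"
      by (simp only: gb_Suc)
    also have "q powi (int x * (L + int a) - int (tri x)) * q powi (L + 2 * int (a - x) + int x) =
        q powi (int a + 1) * q powi (int (Suc x) * (L + int a) - int (tri (Suc x)))"
      unfolding q_powi_add[symmetric]
      by (rule arg_cong[where f = "\<lambda>e. q powi e"]) (use that in \<open>simp add: of_nat_diff tri_Suc algebra_simps\<close>)
    finally show ?thesis by (simp add: P_def ac_simps)
  qed
  \<comment> \<open>The term at x after one more application has two sources, x itself and x - 1;
    their weights add up to [a + 1] because a + 1 = x + (a + 1 - x).\<close>
  have P3: "qint (int a + 1) * P (Suc a) x = P a x * qint (int a + 1 - int x) + q powi (int a + 1) * (qint (int x) * P a x)" for x
  proof -
    have "qint (int a + 1) = qint (int x + (int a + 1 - int x))" by simp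
    also have "\<dots> = q powi (int a + 1 - int x) * qint (int x) + q powi (- int x) * qint (int a + 1 - int x)"
      by (rule qint_add)
    finally have "qint (int a + 1) * q powi int x = q powi (int a + 1) * qint (int x) + qint (int a + 1 - int x)"
      by (simp add: q_powi_diff power_int_minus algebra_simps)
    then show ?thesis
      unfolding P1 mult.assoc[symmetric] by (simp add: algebra_simps)
  qed
  have "sc (qint (int a + 1)) (act (dpow t (int (Suc a))) (g 0 0)) = act t (act (dpow t (int a)) (g 0 0))"
    by (simp add: act_mult_dpow add.commute)
  also have "\<dots> = (\<Sum>x\<le>a. sc (P a x) (act t (g (a - x) x)))"
    unfolding Suc.IH by (simp add: act_sum act_sc[of t] P_def)
  also have "\<dots> = (\<Sum>x\<le>a. sc (P a x * qint (int a + 1 - int x)) (g (Suc a - x) x)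
      + sc (q powi (int a + 1) * (qint (int (Suc x)) * P a (Suc x))) (g (Suc a - Suc x) (Suc x)))"
  proof (rule sum.cong[OF HOL.refl])
    fix x assume "x \<in> {..a}"
    then have x: "x \<le> a" by simp
    have e: "int (a - x) + 1 = int a + 1 - int x" using x by simp
    show "sc (P a x) (act t (g (a - x) x)) = sc (P a x * qint (int a + 1 - int x)) (g (Suc a - x) x)
        + sc (q powi (int a + 1) * (qint (int (Suc x)) * P a (Suc x))) (g (Suc a - Suc x) (Suc x))"
      unfolding assms P2[OF x, symmetric] scale_right_distrib scale_scale Suc_diff_le[OF x] diff_Suc_Suc e ..
  qed
  also have "\<dots> = (\<Sum>x\<le>Suc a. sc (P a x * qint (int a + 1 - int x)) (g (Suc a - x) x))
      + (\<Sum>x\<le>Suc a. sc (q powi (int a + 1) * (qint (int x) * P a x)) (g (Suc a - x) x))"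
    unfolding sum.distrib by (subst (2) sum.atMost_Suc_shift) simp
  also have "\<dots> = (\<Sum>x\<le>Suc a. sc (qint (int a + 1) * P (Suc a) x) (g (Suc a - x) x))"
    unfolding sum.distrib[symmetric] P3 scale_left_distrib ..
  also have "\<dots> = sc (qint (int a + 1)) (\<Sum>x\<le>Suc a. sc (P (Suc a) x) (g (Suc a - x) x))"
    by (simp only: scale_sum_right scale_scale)
  finally show ?case by (simp add: scale_cancel_left P_def)
qed (simp add: tri_def)

end

section \<open>Words in the E_i as functionals separating the monomials\<close>

section \<open>Linear independence of the monomials\<close>

lemma prod_qint_up: "(\<Prod>t<j. qint (int M + 1 + int t)) = qfact (M + j) / qfact M"
  by (induction j) (simp_all add: qfact_Suc add_ac)

lemma prod_qint_falling:
  assumes "l \<le> M"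
  shows "(\<Prod>t<l. qint (int M - int t)) = qfact M / qfact (M - l)"
  using assms
proof (induction l)
  case (Suc l)
  then have "M - l = Suc (M - Suc l)" by simp
  then have "qfact (M - l) = qint (int M - int l) * qfact (M - Suc l)"
    using Suc.prems by (simp add: qfact_Suc of_nat_diff algebra_simps)
  moreover have "qint (int M - int l) \<noteq> 0" using Suc.prems by simp
  ultimately show ?case using Suc by simp
qed simp

context hw_module
begin

lemma E2_power_Fm:
  "act (E I2 ^ j) (Fm k b i) = sc (\<Prod>t<j. qint (int n + i - b + 1 + int t)) (Fm k (b - int j) i)"
proof (induction j)
  case (Suc j)
  have e: "int n + i - (b - int j) + 1 = int n + i - b + 1 + int j" "b - int j - 1 = b - int (Suc j)"
    by simp_all
  have "act (E I2 ^ Suc j) (Fm k b i) = sc (\<Prod>t<j. qint (int n + i - b + 1 + int t)) (act (E I2) (Fm k (b - int j) i))"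
    by (simp only: power_Suc act_mult Suc.IH act_scs)
  also have "\<dots> = sc (\<Prod>t<Suc j. qint (int n + i - b + 1 + int t)) (Fm k (b - int (Suc j)) i)"
    unfolding E2_Fm e by (simp add: mult.commute)
  finally show ?case .
qed simp

text \<open>The scalar by which E_1^(k + i) sends F_1^(k) F_2^(b) F_1^(i) \<eta> to F_2^(b) \<eta>,
  in closed form.\<close>

definition E1_coeff :: "int \<Rightarrow> nat \<Rightarrow> nat \<Rightarrow> Qq" where
  "E1_coeff b k i = qfact (k + i) / (qfact k * qfact i)
     * (\<Prod>t<k. qint (int m + b - int i - int t)) * (\<Prod>t<i. qint (int m - int t))"

text \<open>The recursion that \<open>E1_Fm\<close> imposes; after common factors are taken out it
  is one instance of \<open>qint_three\<close>.\<close>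

lemma E1_coeff_Suc:
  "E1_coeff b (Suc k) (Suc i) = qint (int m - int i) * E1_coeff b (Suc k) i
     + qint (int m - 2 * int (Suc i) + b - int k) * E1_coeff b k (Suc i)"
proof -
  define X where "X = (\<Prod>t<k. qint (int m + b - int (Suc i) - int t))"
  define Y where "Y = (\<Prod>t<i. qint (int m - int t))"
  define D where "D = qfact (k + i + 1) / (qfact (Suc k) * qfact (Suc i))"
  define u where "u = qint (int m - int i)"
  have X1: "(\<Prod>t<Suc k. qint (int m + b - int i - int t)) = qint (int m + b - int i) * X"
    unfolding X_def by (subst prod.lessThan_Suc_shift) (simp add: algebra_simps)
  have X2: "(\<Prod>t<Suc k. qint (int m + b - int (Suc i) - int t)) = qint (int m + b - int (Suc i) - int k) * X"
    unfolding X_def by simp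
  have Y1: "(\<Prod>t<Suc i. qint (int m - int t)) = u * Y"
    unfolding Y_def u_def by simp
  have c1: "E1_coeff b (Suc k) (Suc i) = D * qint ((int k + 1) + (int i + 1)) * (qint (int m + b - int (Suc i) - int k) * X) * (u * Y)"
    unfolding E1_coeff_def X2 Y1 by (simp add: D_def qfact_Suc ac_simps)
  have c2: "E1_coeff b (Suc k) i = D * qint (int i + 1) * (qint (int m + b - int i) * X) * Y"
    unfolding E1_coeff_def X1 Y_def[symmetric] by (simp add: D_def qfact_Suc[of i])
  have c3: "E1_coeff b k (Suc i) = D * qint (int k + 1) * X * (u * Y)"
    unfolding E1_coeff_def X_def[symmetric] Y1 by (simp add: D_def qfact_Suc[of k])
  have e: "int m + b - int (Suc i) - int k + (int k + 1) = int m + b - int i"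
    "int m + b - int (Suc i) - int k - (int i + 1) = int m - 2 * int (Suc i) + b - int k" by simp_all
  have three: "qint ((int k + 1) + (int i + 1)) * qint (int m + b - int (Suc i) - int k) =
      qint (int i + 1) * qint (int m + b - int i) + qint (int k + 1) * qint (int m - 2 * int (Suc i) + b - int k)"
    by (subst qint_three) (simp only: e)
  have "E1_coeff b (Suc k) (Suc i) =
      D * (qint ((int k + 1) + (int i + 1)) * qint (int m + b - int (Suc i) - int k)) * X * (u * Y)"
    unfolding c1 by (simp only: mult_ac)
  also have "\<dots> = u * E1_coeff b (Suc k) i + qint (int m - 2 * int (Suc i) + b - int k) * E1_coeff b k (Suc i)"
    unfolding c2 c3 three by (simp only: ring_distribs mult_ac)
  finally show ?thesis unfolding u_def .
qed

lemma E1_coeff_0: "E1_coeff b 0 (Suc i) = qint (int m - int i) * E1_coeff b 0 i"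
  "E1_coeff b (Suc k) 0 = qint (int m + b - int k) * E1_coeff b k 0"
  by (simp_all add: E1_coeff_def mult.commute)

lemma E1_power_Fm: "act (E I1 ^ (k + i)) (Fm (int k) b (int i)) = sc (E1_coeff b k i) (Fm 0 b 0)"
proof (induction "k + i" arbitrary: k i)
  case 0
  then show ?case by (simp add: E1_coeff_def)
next
  case (Suc l)
  have "act (E I1 ^ (k + i)) (Fm (int k) b (int i)) = act (E I1 ^ l) (act (E I1) (Fm (int k) b (int i)))"
    by (simp add: Suc.hyps(2)[symmetric] power_Suc2 act_mult del: power_Suc)
  also have "\<dots> = sc (qint (int m - int i + 1)) (act (E I1 ^ l) (Fm (int k) b (int i - 1)))
      + sc (qint (int m - 2 * int i + b - int k + 1)) (act (E I1 ^ l) (Fm (int k - 1) b (int i)))"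
    by (simp add: E1_Fm act_add act_scs)
  also have "\<dots> = sc (E1_coeff b k i) (Fm 0 b 0)"
  proof (cases k; cases i)
    fix k' i' assume k: "k = Suc k'" and i: "i = Suc i'"
    have "act (E I1 ^ l) (Fm (int k) b (int i')) = sc (E1_coeff b k i') (Fm 0 b 0)"
      using Suc.hyps(1)[of k i'] Suc.hyps(2) i by simp
    moreover have "act (E I1 ^ l) (Fm (int k') b (int i)) = sc (E1_coeff b k' i) (Fm 0 b 0)"
      using Suc.hyps(1)[of k' i] Suc.hyps(2) k by simp
    ultimately show ?thesis
      using E1_coeff_Suc[of b k' i'] by (simp add: k i scale_left_distrib algebra_simps)
  next
    fix k' assume k: "k = Suc k'" and i: "i = 0"
    have "act (E I1 ^ l) (Fm (int k') b (int i)) = sc (E1_coeff b k' i) (Fm 0 b 0)"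
      using Suc.hyps(1)[of k' i] Suc.hyps(2) k by simp
    then show ?thesis by (simp add: k i Fm_neg E1_coeff_0 add_diff_eq)
  next
    fix i' assume k: "k = 0" and i: "i = Suc i'"
    have "act (E I1 ^ l) (Fm (int k) b (int i')) = sc (E1_coeff b k i') (Fm 0 b 0)"
      using Suc.hyps(1)[of k i'] Suc.hyps(2) i by simp
    then show ?thesis by (simp add: k i Fm_neg E1_coeff_0)
  next
    assume "k = 0" "i = 0"
    then show ?thesis using Suc.hyps(2) by simp
  qed
  finally show ?case .
qed

lemma E1_power_Fm_0:
  assumes "k + i < l"
  shows "act (E I1 ^ l) (Fm (int k) b (int i)) = 0"
proof -
  obtain l' where l: "l = Suc l' + (k + i)"
    using assms by (metis add.commute add_Suc less_iff_Suc_add)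
  have "act (E I1) (Fm 0 b 0) = 0" by (simp add: E1_Fm Fm_neg)
  then show ?thesis
    unfolding l power_add[of _ "Suc l'"] power_Suc2 act_mult E1_power_Fm by (simp only: act_scs act_0 scale_zero_right)
qed

text \<open>On a monomial with A factors F_1 and b factors F_2 the value, for j <= b, is a multiple
  of \<eta>, so j indexes a family of functionals.\<close>

definition pairing :: "nat \<Rightarrow> nat \<Rightarrow> nat \<Rightarrow> 'v \<Rightarrow> 'v" where
  "pairing A b j v = act (E I2 ^ (b - j)) (act (E I1 ^ A) (act (E I2 ^ j) v))"

lemma pairing_sc: "pairing A b j (sc c v) = sc c (pairing A b j v)"
  and pairing_add: "pairing A b j (v + w) = pairing A b j v + pairing A b j w"
  and pairing_0: "pairing A b j 0 = 0"
  by (simp_all add: pairing_def act_scs act_add)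

lemma pairing_sum: "pairing A b j (sum f S) = (\<Sum>i\<in>S. pairing A b j (f i))"
  by (induction S rule: infinite_finite_induct) (simp_all add: pairing_add pairing_0)

lemma pairing_Fm_lower: "k + i < A \<Longrightarrow> pairing A b j (Fm (int k) b' (int i)) = 0"
  by (simp add: pairing_def E2_power_Fm act_scs E1_power_Fm_0)

text \<open>The scalar is arranged as a factor in j, a factor in i, and a product of two factorials
  that sees only i + j: the Hankel matrix of \<open>hankel_independent\<close>.\<close>

lemma pairing_Fm:
  assumes "i \<le> A" "A \<le> b" "i \<le> m" "b \<le> n + i" "j \<le> A" "j \<le> m" "b \<le> n + j"
  shows "pairing A b j (Fm (int A - int i) (int b) (int i)) =
    sc (qfact A * qfact n / (qfact (m + b - j - A) * qfact (n + j - b))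
      * ((\<Prod>t<i. qint (int m - int t)) / (qfact (n + i - b) * qfact (A - i) * qfact i)
         * (qfact (n + i + j - b) * qfact (m + b - i - j)))) \<eta>"
proof -
  have e1: "int n + int i - int b + 1 = int (n + i - b) + 1" using assms by simp
  have s1: "(\<Prod>t<j. qint (int n + int i - int b + 1 + int t)) = qfact (n + i + j - b) / qfact (n + i - b)"
    unfolding e1 using prod_qint_up[of "n + i - b" j] assms by simp
  have e2: "int m + (int b - int j) - int i = int (m + b - i - j)" using assms by simp
  have s2: "(\<Prod>t<A - i. qint (int m + (int b - int j) - int i - int t)) = qfact (m + b - i - j) / qfact (m + b - j - A)"
  proof -
    have "m + b - i - j - (A - i) = m + b - j - A" using assms by simp
    then show ?thesis
      unfolding e2 using prod_qint_falling[of "A - i" "m + b - i - j"] assms by simp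
  qed
  have s3: "(\<Prod>t<b - j. qint (int n + 0 - (int b - int j) + 1 + int t)) = qfact n / qfact (n + j - b)"
  proof -
    have e: "int n + 0 - (int b - int j) + 1 = int (n + j - b) + 1" "n + j - b + (b - j) = n"
      using assms by simp_all
    show ?thesis unfolding e(1) using prod_qint_up[of "n + j - b" "b - j"] unfolding e(2) .
  qed
  have Ai: "int A - int i = int (A - i)" "A - i + i = A" using assms by simp_all
  have c: "E1_coeff (int b - int j) (A - i) i =
      qfact A / (qfact (A - i) * qfact i) * (qfact (m + b - i - j) / qfact (m + b - j - A)) * (\<Prod>t<i. qint (int m - int t))"
    unfolding E1_coeff_def Ai(2) s2 ..
  have h1: "act (E I1 ^ A) (Fm (int A - int i) (int b - int j) (int i)) = sc (E1_coeff (int b - int j) (A - i) i) (Fm 0 (int b - int j) 0)"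
    using E1_power_Fm[of "A - i" i "int b - int j"] unfolding Ai .
  have h2: "act (E I2 ^ (b - j)) (Fm 0 (int b - int j) 0) = sc (qfact n / qfact (n + j - b)) \<eta>"
    unfolding E2_power_Fm s3 using assms by (simp add: Fm_eq of_nat_diff)
  have h0: "act (E I2 ^ j) (Fm (int A - int i) (int b) (int i)) =
      sc (qfact (n + i + j - b) / qfact (n + i - b)) (Fm (int A - int i) (int b - int j) (int i))"
    unfolding E2_power_Fm s1 ..
  show ?thesis
    unfolding pairing_def h0 act_scs h1 h2 scale_scale c by (simp add: mult_ac)
qed

lemma sc_eta_eq_0: "sc c \<eta> = 0 \<longleftrightarrow> c = 0"
  using \<eta>_nz by simp

end

section \<open>The filtration of the monomials by level\<close>

locale icb_uniqueness = hw_module act m n \<eta>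
  for act :: "Uq \<Rightarrow> 'v \<Rightarrow> 'v::ab_group_add" and m n :: nat and \<eta> :: 'v +
  fixes a b c :: nat
  assumes bac: "a + c \<le> b" and cm: "c \<le> m" and bnc: "b \<le> n + c"
begin

definition f :: "nat \<Rightarrow> nat \<Rightarrow> 'v" where
  "f x y = Fm (int a - int x) (int b - int x - int y) (int c - int y)"

text \<open>The level x + y fixes the weight of \<open>f x y\<close>, which has a + c - x - y
  factors F_1 and b - x - y factors F_2.\<close>

definition W :: "nat \<Rightarrow> 'v set" where
  "W s = span {f x y | x y. s \<le> x + y}"

lemma f_0: "x > a \<or> y > c \<Longrightarrow> f x y = 0"
  by (auto simp: f_def Fm_neg)

lemma W_subspace: "subspace (W s)"
  by (simp add: W_def)

lemma f_in_W: "s \<le> x + y \<Longrightarrow> f x y \<in> W s"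
  unfolding W_def by (rule span_base) blast

lemma W_mono: "s \<le> s' \<Longrightarrow> W s' \<subseteq> W s"
  unfolding W_def by (rule span_mono) (blast intro: order_trans)

lemma W_top: "v \<in> W (Suc (a + c)) \<Longrightarrow> v = 0"
proof -
  have "{f x y | x y. Suc (a + c) \<le> x + y} \<subseteq> {0}"
    using f_0 by auto (metis add_mono not_less not_less_eq_eq)
  then have "W (Suc (a + c)) \<subseteq> span {0}"
    unfolding W_def by (rule span_mono)
  then show "v \<in> W (Suc (a + c)) \<Longrightarrow> v = 0" by auto
qed

text \<open>Beyond level s there are fewer than a + c - s factors F_1, so this power of E_1 kills
  the vector.\<close>

lemma pairing_W:
  assumes "s \<le> a + c" "v \<in> W (Suc s)"
  shows "pairing (a + c - s) (b - s) j v = 0"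
  using assms(2) unfolding W_def
proof (induction rule: span_induct)
  case base
  show ?case
    by (simp add: subspace_def pairing_0 pairing_add pairing_sc)
next
  case (step v)
  then obtain x y where v: "v = f x y" and s: "Suc s \<le> x + y" by auto
  show ?case
  proof (cases "x \<le> a \<and> y \<le> c")
    case True
    then have "f x y = Fm (int (a - x)) (int b - int x - int y) (int (c - y))"
      by (simp add: f_def of_nat_diff)
    moreover have "a - x + (c - y) < a + c - s"
      using True s assms(1) by linarith
    ultimately show ?thesis
      using pairing_Fm_lower[of "a - x" "c - y"] by (simp only: v)
  next
    case False
    then show ?thesis using f_0[of x y] by (auto simp: v pairing_0)
  qed
qed

text \<open>Pairing the combination kills its part in \<open>W (Suc s)\<close> and leaves, for each
  j, one linear equation in the rescaled coefficients; these equations form a regular Hankel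
  system.\<close>

lemma level_independent:
  assumes s: "s \<le> a + c"
    and mem: "(\<Sum>(x, y) | x \<le> a \<and> y \<le> c \<and> x + y = s. sc (h x y) (f x y)) \<in> W (Suc s)"
    and xy: "x \<le> a" "y \<le> c" "x + y = s"
  shows "h x y = 0"
proof -
  define A where "A = a + c - s"
  define b' where "b' = b - s"
  have Ab: "A \<le> b'" using bac s by (simp add: A_def b'_def)
  have bs: "s \<le> b" using bac s by simp
  \<comment> \<open>The range from \<open>i0\<close> to \<open>i1\<close> is where
    \<open>pairing_Fm\<close> applies. The subtraction is truncated, so \<open>i0\<close> is 0 when
    b' <= n.\<close>
  define i0 where "i0 = b' - n"
  define i1 where "i1 = min A m"
  \<comment> \<open>The level is indexed by the inner exponent i = c - y, and the coefficients are
    extended by zero to the whole range, which makes the system square in i and j.\<close>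
  define H where "H i = (if i \<le> c \<and> c - i \<le> s \<and> s - (c - i) \<le> a then h (s - (c - i)) (c - i) else 0)" for i
  define C where "C i = H i * ((\<Prod>t<i. qint (int m - int t)) / (qfact (n + i - b') * qfact (A - i) * qfact i))" for i
  define u where "u j = qfact A * qfact n / (qfact (m + b' - j - A) * qfact (n + j - b'))" for j
  have valid: "i0 \<le> i \<and> i \<le> i1" if "i \<le> c" "c - i \<le> s" "s - (c - i) \<le> a" for i
    using that bnc cm s bs by (auto simp: i0_def i1_def A_def b'_def)
  have fi: "f (s - (c - i)) (c - i) = Fm (int A - int i) (int b') (int i)" if "i \<le> c" "c - i \<le> s" for i
    using that s bs by (simp add: f_def A_def b'_def of_nat_diff algebra_simps)
  have key: "(\<Sum>i\<in>{i0..i1}. C i * (qfact (n + i + j - b') * qfact (m + b' - i - j))) = 0"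
    if j: "i0 \<le> j" "j \<le> i1" for j
  proof -
    have pf: "sc (H i) (pairing A b' j (Fm (int A - int i) (int b') (int i))) =
        sc (u j) (sc (C i * (qfact (n + i + j - b') * qfact (m + b' - i - j))) \<eta>)" if "i0 \<le> i" "i \<le> i1" for i
    proof -
      have "i \<le> A" "i \<le> m" "b' \<le> n + i" "j \<le> A" "j \<le> m" "b' \<le> n + j"
        using that j by (auto simp: i0_def i1_def)
      then show ?thesis
        using pairing_Fm[of i A b' j] Ab by (simp add: u_def C_def mult_ac)
    qed
    have "0 = pairing A b' j (\<Sum>(x, y) | x \<le> a \<and> y \<le> c \<and> x + y = s. sc (h x y) (f x y))"
      using pairing_W[OF s mem, of j] by (simp add: A_def b'_def)
    also have "\<dots> = (\<Sum>(x, y) | x \<le> a \<and> y \<le> c \<and> x + y = s. sc (h x y) (pairing A b' j (f x y)))"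
      by (simp add: pairing_sum pairing_sc case_prod_unfold)
    also have "\<dots> = (\<Sum>i | i \<le> c \<and> c - i \<le> s \<and> s - (c - i) \<le> a. sc (H i) (pairing A b' j (Fm (int A - int i) (int b') (int i))))"
      by (rule sum.reindex_bij_witness[of _ "\<lambda>i. (s - (c - i), c - i)" "\<lambda>(x, y). c - y"])
        (auto simp: H_def fi[symmetric])
    also have "\<dots> = (\<Sum>i\<in>{i0..i1}. sc (H i) (pairing A b' j (Fm (int A - int i) (int b') (int i))))"
      by (rule sum.mono_neutral_left) (use valid in \<open>auto simp: H_def\<close>)
    also have "\<dots> = (\<Sum>i\<in>{i0..i1}. sc (u j) (sc (C i * (qfact (n + i + j - b') * qfact (m + b' - i - j))) \<eta>))"
      by (rule sum.cong) (use pf in auto)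
    also have "\<dots> = sc (u j) (sc (\<Sum>i\<in>{i0..i1}. C i * (qfact (n + i + j - b') * qfact (m + b' - i - j))) \<eta>)"
      by (simp only: scale_sum_right scale_sum_left)
    finally have "sc (u j) (sc (\<Sum>i\<in>{i0..i1}. C i * (qfact (n + i + j - b') * qfact (m + b' - i - j))) \<eta>) = 0" ..
    moreover have "u j \<noteq> 0" by (simp add: u_def)
    ultimately show ?thesis by (simp only: scale_eq_0_iff sc_eta_eq_0) (simp add: \<eta>_nz)
  qed
  define i where "i = c - y"
  have i: "i \<le> c" "c - i \<le> s" "s - (c - i) \<le> a" "c - i = y" "s - y = x"
    using xy by (auto simp: i_def)
  have ii: "i0 \<le> i" "i \<le> i1" using valid[OF i(1-3)] by auto
  have "C (i0 + (i - i0)) = 0"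
  proof (rule hankel_independent[where N = "i1 - i0" and r = "m + b' - 2 * i0" and p = "n + 2 * i0 - b'" and c = "\<lambda>i. C (i0 + i)"])
    \<comment> \<open>The bounds i1 <= m and i1 <= A <= b' give this; the shift by \<open>i0\<close>
      makes the indices start at 0.\<close>
    show "2 * (i1 - i0) \<le> m + b' - 2 * i0" using Ab ii by (auto simp: i1_def)
    show "i - i0 \<le> i1 - i0" using ii by simp
  next
    fix j assume j: "j \<le> i1 - i0"
    have "(\<Sum>i\<le>i1 - i0. C (i0 + i) * (qfact (n + 2 * i0 - b' + i + j) * qfact (m + b' - 2 * i0 - i - j))) =
        (\<Sum>i\<in>{i0..i1}. C i * (qfact (n + i + (i0 + j) - b') * qfact (m + b' - i - (i0 + j))))"
    proof (rule sum.reindex_bij_witness[of _ "\<lambda>i. i - i0" "\<lambda>i. i0 + i"])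
      fix i assume "i \<in> {..i1 - i0}"
      have "n + (i0 + i) + (i0 + j) - b' = n + 2 * i0 - b' + i + j" by (simp add: i0_def)
      moreover have "m + b' - (i0 + i) - (i0 + j) = m + b' - 2 * i0 - i - j" by simp
      ultimately show "C (i0 + i) * (qfact (n + (i0 + i) + (i0 + j) - b') * qfact (m + b' - (i0 + i) - (i0 + j))) =
          C (i0 + i) * (qfact (n + 2 * i0 - b' + i + j) * qfact (m + b' - 2 * i0 - i - j))" by simp
    qed (use ii in auto)
    also have "\<dots> = 0" using key[of "i0 + j"] j ii by simp
    finally show "(\<Sum>i\<le>i1 - i0. C (i0 + i) * (qfact (n + 2 * i0 - b' + i + j) * qfact (m + b' - 2 * i0 - i - j))) = 0" .
  qed
  then have "C i = 0" using ii by simp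
  moreover have "(\<Prod>t<i. qint (int m - int t)) \<noteq> 0" using ii by (auto simp: i1_def)
  ultimately have "H i = 0" by (simp add: C_def)
  then show ?thesis using i by (simp add: H_def)
qed

end

section \<open>Integrality and expansion of the B-monomials\<close>

section \<open>The icanonical basis\<close>

text \<open>The top power of q in this balanced binomial is q^(My); after removing it,
  \<open>gb_pascal\<close> has only nonpositive powers as coefficients.\<close>

lemma gb_nat_qinv_polys: "q powi (- (int M * int y)) * gb (int M) y \<in> qinv_polys"
proof (induction M arbitrary: y)
  case 0
  have "gb 0 y = 1" using prod_qint_up[where M = 0 and j = y] by (simp add: gb_def)
  then show ?case by simp
next
  case (Suc M)
  show ?case
  proof (induction y)
    case (Suc y)
    have "q powi (- (int (Suc M) * int (Suc y))) * gb (int (Suc M)) (Suc y) =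
        (q powi (- (int (Suc M) * int (Suc y))) * q powi (int y + 1)) * gb (int M) (Suc y)
        + (q powi (- (int (Suc M) * int (Suc y))) * q powi (- int M - 1)) * gb (int (Suc M)) y"
      using gb_pascal[of "int M" y] by (simp add: algebra_simps)
    also have "q powi (- (int (Suc M) * int (Suc y))) * q powi (int y + 1) = q powi (- (int M * int (Suc y)))"
      unfolding q_powi_add[symmetric] by (rule arg_cong[where f = "\<lambda>e. q powi e"]) (simp add: algebra_simps)
    also have "q powi (- (int (Suc M) * int (Suc y))) * q powi (- int M - 1) =
        q powi (- 2 * int (Suc M)) * q powi (- (int (Suc M) * int y))"
      unfolding q_powi_add[symmetric] by (rule arg_cong[where f = "\<lambda>e. q powi e"]) (simp add: algebra_simps)
    finally have "q powi (- (int (Suc M) * int (Suc y))) * gb (int (Suc M)) (Suc y) =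
        q powi (- (int M * int (Suc y))) * gb (int M) (Suc y)
        + q powi (- 2 * int (Suc M)) * (q powi (- (int (Suc M) * int y)) * gb (int (Suc M)) y)"
      by (simp only: mult.assoc)
    moreover have "q powi (- 2 * int (Suc M)) \<in> qinv_polys"
      by (rule qinv_polys_powi) simp
    ultimately show ?case
      using Suc.IH \<open>\<And>y. q powi (- (int M * int y)) * gb (int M) y \<in> qinv_polys\<close>[of "Suc y"]
      by (simp only: qinv_polys_add qinv_polys_mult)
  qed simp
qed

context hw_module
begin

lemma dpow_B1_Fm:
  "act (dpow (B \<sigma> I1) (int a)) (Fm 0 b c) =
    (\<Sum>x\<le>a. sc (q powi (int x * (\<sigma> I1 - int m + 2 * c - b + int a) - int (tri x)) * gb (int n + c - b) x)
      (Fm (int a - int x) (b - int x) c))"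
proof -
  have "act (B \<sigma> I1) (Fm (int k) (b - int x) c) = sc (qint (int k + 1)) (Fm (int (Suc k)) (b - int x) c)
      + sc (q powi ((\<sigma> I1 - int m + 2 * c - b) + 2 * int k + int x) * qint ((int n + c - b) + int x + 1))
          (Fm (int k) (b - int (Suc x)) c)" for k x
  proof -
    have e: "\<sigma> I1 - int m + 2 * c - (b - int x) + 2 * int k = (\<sigma> I1 - int m + 2 * c - b) + 2 * int k + int x"
      "int n + c - (b - int x) + 1 = (int n + c - b) + int x + 1" "b - int x - 1 = b - int (Suc x)"
      "int k + 1 = int (Suc k)" by simp_all
    show ?thesis unfolding B1_Fm e ..
  qed
  from dpow_expansion[of "B \<sigma> I1" "\<lambda>k x. Fm (int k) (b - int x) c", OF this, of a] show ?thesis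
    by (simp add: of_nat_diff cong: sum.cong_simp)
qed

lemma dpow_B2_Fm:
  "act (dpow (B \<sigma> I2) (int b)) (Fm 0 0 c) =
    (\<Sum>y\<le>b. sc (q powi (int y * (\<sigma> I2 - int n - c + int b) - int (tri y)) * gb (int m - c) y)
      (Fm 0 (int b - int y) (c - int y)))"
proof -
  have "act (B \<sigma> I2) (Fm 0 (int k) (c - int x)) = sc (qint (int k + 1)) (Fm 0 (int (Suc k)) (c - int x))
      + sc (q powi ((\<sigma> I2 - int n - c) + 2 * int k + int x) * qint ((int m - c) + int x + 1))
          (Fm 0 (int k) (c - int (Suc x)))" for k x
  proof -
    have e: "\<sigma> I2 - int n - (c - int x) + 2 * int k = (\<sigma> I2 - int n - c) + 2 * int k + int x"
      "int m - (c - int x) + 1 = (int m - c) + int x + 1" "c - int x - 1 = c - int (Suc x)"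
      "int k + 1 = int (Suc k)" by simp_all
    show ?thesis unfolding B2_Fm e ..
  qed
  from dpow_expansion[of "B \<sigma> I2" "\<lambda>k x. Fm 0 (int k) (c - int x)", OF this, of b] show ?thesis
    by (simp add: of_nat_diff cong: sum.cong_simp)
qed

text \<open>Every term with x > 0 contains a negative divided power of F_2 and vanishes.\<close>

lemma dpow_B1_eta: "act (dpow (B \<sigma> I1) (int c)) \<eta> = Fm 0 0 (int c)"
proof -
  have "act (dpow (B \<sigma> I1) (int c)) \<eta> = act (dpow (B \<sigma> I1) (int c)) (Fm 0 0 0)"
    by (simp add: Fm_eq)
  also have "\<dots> = (\<Sum>x\<le>c. if x = 0 then Fm (int c) 0 0 else 0)"
    unfolding dpow_B1_Fm by (rule sum.cong) (auto simp: Fm_neg)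
  finally show ?thesis by (simp add: Fm_eq)
qed

text \<open>The inner power of B_1 is plain F_1^(c); then B_2 produces y and B_1 produces x.
  Lowering b and c by y preserves n + c - b and shifts the exponent of the x-part by -xy, the only
  interaction of the two sums.\<close>

lemma Bmon_expansion:
  "Bmon \<sigma> act \<eta> (int a) (int b) (int c) =
    (\<Sum>x\<le>a. \<Sum>y\<le>b. sc (q powi (- (int x * int y))
        * (q powi (int x * (\<sigma> I1 - int m + 2 * int c - int b + int a) - int (tri x)) * gb (int n + int c - int b) x)
        * (q powi (int y * (\<sigma> I2 - int n - int c + int b) - int (tri y)) * gb (int m - int c) y))
      (Fm (int a - int x) (int b - int x - int y) (int c - int y)))"
proof -
  define R where "R y = q powi (int y * (\<sigma> I2 - int n - int c + int b) - int (tri y)) * gb (int m - int c) y" for y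
  have "Bmon \<sigma> act \<eta> (int a) (int b) (int c) =
      (\<Sum>y\<le>b. sc (R y) (act (dpow (B \<sigma> I1) (int a)) (Fm 0 (int b - int y) (int c - int y))))"
    by (simp add: Bmon_def act_mult dpow_B1_eta dpow_B2_Fm act_sum act_scs R_def)
  also have "\<dots> = (\<Sum>y\<le>b. \<Sum>x\<le>a. sc (q powi (- (int x * int y))
        * (q powi (int x * (\<sigma> I1 - int m + 2 * int c - int b + int a) - int (tri x)) * gb (int n + int c - int b) x)
        * R y) (Fm (int a - int x) (int b - int x - int y) (int c - int y)))"
  proof (rule sum.cong[OF HOL.refl])
    fix y
    have "R y * (q powi (int x * (\<sigma> I1 - int m + 2 * (int c - int y) - (int b - int y) + int a) - int (tri x))
          * gb (int n + (int c - int y) - (int b - int y)) x) =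
        q powi (- (int x * int y))
        * (q powi (int x * (\<sigma> I1 - int m + 2 * int c - int b + int a) - int (tri x)) * gb (int n + int c - int b) x)
        * R y" for x
    proof -
      have "q powi (int x * (\<sigma> I1 - int m + 2 * (int c - int y) - (int b - int y) + int a) - int (tri x)) =
          q powi (- (int x * int y)) * q powi (int x * (\<sigma> I1 - int m + 2 * int c - int b + int a) - int (tri x))"
        unfolding q_powi_add[symmetric] by (rule arg_cong[where f = "\<lambda>e. q powi e"]) (simp add: algebra_simps)
      moreover have "int n + (int c - int y) - (int b - int y) = int n + int c - int b" by simp
      ultimately show ?thesis by (simp only: mult_ac)
    qed
    moreover have "int b - int y - int x = int b - int x - int y" for x by simp
    ultimately show "sc (R y) (act (dpow (B \<sigma> I1) (int a)) (Fm 0 (int b - int y) (int c - int y))) =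
      (\<Sum>x\<le>a. sc (q powi (- (int x * int y))
        * (q powi (int x * (\<sigma> I1 - int m + 2 * int c - int b + int a) - int (tri x)) * gb (int n + int c - int b) x)
        * R y) (Fm (int a - int x) (int b - int x - int y) (int c - int y)))"
      unfolding dpow_B1_Fm scale_sum_right scale_scale by (simp only:)
  qed
  also have "\<dots> = (\<Sum>x\<le>a. \<Sum>y\<le>b. sc (q powi (- (int x * int y))
        * (q powi (int x * (\<sigma> I1 - int m + 2 * int c - int b + int a) - int (tri x)) * gb (int n + int c - int b) x)
        * R y) (Fm (int a - int x) (int b - int x - int y) (int c - int y)))"
    by (rule sum.swap)
  finally show ?thesis unfolding R_def .
qed

lemma triangle_sum:
  fixes l :: nat
  shows "(\<Sum>j\<le>l. sc (A j) (\<Sum>x\<le>l - j. sc (T j x) (g (j + x)))) =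
     (\<Sum>z\<le>l. sc (\<Sum>j\<le>z. A j * T j (z - j)) (g z))"
proof -
  have "(\<Sum>j\<le>l. sc (A j) (\<Sum>x\<le>l - j. sc (T j x) (g (j + x)))) =
      (\<Sum>j\<le>l. \<Sum>x\<le>l - j. sc (A j * T j x) (g (j + x)))"
    by (simp add: scale_sum_right)
  also have "\<dots> = (\<Sum>(j, x)\<in>{(j, x). j + x \<le> l}. sc (A j * T j x) (g (j + x)))"
    by (subst sum.Sigma) (auto intro!: sum.cong)
  also have "\<dots> = (\<Sum>z\<le>l. \<Sum>j\<le>z. sc (A j * T j (z - j)) (g z))"
    unfolding sum.triangle_reindex_eq by (intro sum.cong HOL.refl) simp
  finally show ?thesis by (simp only: scale_sum_left)
qed

end

section \<open>Unitriangularity of the bar involution and uniqueness of the icanonical basis\<close>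

locale icb_module = icb_uniqueness act m n \<eta> a b c
  for act :: "Uq \<Rightarrow> 'v \<Rightarrow> 'v::ab_group_add" and m n :: nat and \<eta> :: 'v and a b c :: nat +
  fixes \<sigma> :: "idx \<Rightarrow> int" and psi :: "Uq \<Rightarrow> Uq" and psiL :: "'v \<Rightarrow> 'v"
  assumes ibar: "is_ibar \<sigma> psi" and ibarL: "is_ibar_module \<sigma> psi act \<eta> psiL"
begin

lemma psiL_add: "psiL (v + w) = psiL v + psiL w"
  and psiL_sc: "psiL (sc k v) = sc (bar k) (psiL v)"
  and psiL_act: "u \<in> Ui \<sigma> \<Longrightarrow> psiL (act u \<eta>) = act (psi u) \<eta>"
  using ibarL by (simp_all add: is_ibar_module_def)

lemma psiL_0: "psiL 0 = 0"
  using psiL_add[of 0 0] by simp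

lemma psiL_diff: "psiL (v - w) = psiL v - psiL w"
  using psiL_add[of "v - w" w] by (simp add: algebra_simps)

lemma psiL_sum: "psiL (sum g S) = (\<Sum>i\<in>S. psiL (g i))"
  by (induction S rule: infinite_finite_induct) (simp_all add: psiL_0 psiL_add)

lemma psi_mult: "x \<in> Ui \<sigma> \<Longrightarrow> y \<in> Ui \<sigma> \<Longrightarrow> psi (x * y) = psi x * psi y"
  and psi_scal: "psi (scal k) = scal (bar k)"
  and psi_B: "psi (B \<sigma> i) = B \<sigma> i"
  using ibar by (simp_all add: is_ibar_def)

lemma B_power: "B \<sigma> i ^ r \<in> Ui \<sigma> \<and> psi (B \<sigma> i ^ r) = B \<sigma> i ^ r"
proof (induction r)
  case 0
  show ?case using Ui.scal[of 1 \<sigma>] psi_scal[of 1] by (simp add: scal_1)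
next
  case (Suc r)
  then show ?case by (simp add: Ui.mult Ui.B psi_mult psi_B)
qed

lemma B_dpow: "dpow (B \<sigma> i) r \<in> Ui \<sigma> \<and> psi (dpow (B \<sigma> i) r) = dpow (B \<sigma> i) r"
proof (cases "r < 0")
  case True
  then show ?thesis using Ui.scal[of 0 \<sigma>] psi_scal[of 0] by (simp add: scal_0)
next
  case False
  then show ?thesis
    using B_power[of i "nat r"] by (simp add: dpow_def Ui.mult Ui.scal psi_mult psi_scal bar_inverse)
qed

lemma psiL_Bmon: "psiL (Bmon \<sigma> act \<eta> r s t) = Bmon \<sigma> act \<eta> r s t"
  unfolding Bmon_def by (subst psiL_act) (simp_all add: B_dpow Ui.mult psi_mult)

lemma Bmon_triangular:
  assumes "x \<le> a" "y \<le> c"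
  shows "Bmon \<sigma> act \<eta> (int a - int x) (int b - int x - int y) (int c - int y) - f x y \<in> W (Suc (x + y))"
proof -
  have e: "int a - int x = int (a - x)" "int b - int x - int y = int (b - x - y)" "int c - int y = int (c - y)"
    using assms bac by simp_all
  have fe: "Fm (int (a - x) - int x') (int (b - x - y) - int x' - int y') (int (c - y) - int y') = f (x + x') (y + y')" for x' y'
    unfolding f_def e[symmetric] by (simp add: algebra_simps)
  define k where "k x' y' = q powi (- (int x' * int y'))
      * (q powi (int x' * (\<sigma> I1 - int m + 2 * int (c - y) - int (b - x - y) + int (a - x)) - int (tri x'))
        * gb (int n + int (c - y) - int (b - x - y)) x')
      * (q powi (int y' * (\<sigma> I2 - int n - int (c - y) + int (b - x - y)) - int (tri y'))
        * gb (int m - int (c - y)) y')" for x' y'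
  have k0: "k 0 0 = 1" by (simp add: k_def)
  have k: "Bmon \<sigma> act \<eta> (int a - int x) (int b - int x - int y) (int c - int y) =
      (\<Sum>x'\<le>a - x. \<Sum>y'\<le>b - x - y. sc (k x' y') (f (x + x') (y + y')))"
    unfolding e Bmon_expansion fe k_def ..
  have "(\<Sum>x'\<le>a - x. \<Sum>y'\<le>b - x - y. sc (k x' y') (f (x + x') (y + y'))) =
      (\<Sum>p\<in>{..a - x} \<times> {..b - x - y}. sc (k (fst p) (snd p)) (f (x + fst p) (y + snd p)))"
    by (simp add: sum.cartesian_product case_prod_unfold)
  also have "\<dots> = f x y + (\<Sum>p\<in>{..a - x} \<times> {..b - x - y} - {(0, 0)}. sc (k (fst p) (snd p)) (f (x + fst p) (y + snd p)))"
    by (subst sum.remove[of _ "(0, 0)"]) (simp_all add: k0)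
  finally have "Bmon \<sigma> act \<eta> (int a - int x) (int b - int x - int y) (int c - int y) - f x y =
      (\<Sum>p\<in>{..a - x} \<times> {..b - x - y} - {(0, 0)}. sc (k (fst p) (snd p)) (f (x + fst p) (y + snd p)))"
    unfolding k by simp
  also have "\<dots> \<in> W (Suc (x + y))"
  proof (rule subspace_sum[OF W_subspace])
    fix p assume "p \<in> {..a - x} \<times> {..b - x - y} - {(0, 0)}"
    then have "fst p + snd p > 0" by (cases p) auto
    then show "sc (k (fst p) (snd p)) (f (x + fst p) (y + snd p)) \<in> W (Suc (x + y))"
      by (intro subspace_scale[OF W_subspace] f_in_W) linarith
  qed
  finally show ?thesis .
qed

text \<open>The B-monomial M is invariant and leads with f, so the error is (M - f) - psiL (M - f).
  Stability of the next level is a hypothesis because \<open>psiL_W\<close> derives it in the same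
  downward induction.\<close>

lemma psiL_f:
  assumes "\<And>v. v \<in> W (Suc (x + y)) \<Longrightarrow> psiL v \<in> W (Suc (x + y))"
  shows "psiL (f x y) - f x y \<in> W (Suc (x + y))"
proof (cases "x \<le> a \<and> y \<le> c")
  case True
  define M where "M = Bmon \<sigma> act \<eta> (int a - int x) (int b - int x - int y) (int c - int y)"
  have M: "M - f x y \<in> W (Suc (x + y))"
    using Bmon_triangular True by (simp add: M_def)
  have "psiL (M - f x y) = M - psiL (f x y)"
    by (simp add: psiL_diff M_def psiL_Bmon)
  then have eq: "psiL (f x y) - f x y = (M - f x y) - psiL (M - f x y)" by simp
  show ?thesis
    unfolding eq by (rule subspace_diff[OF W_subspace M assms[OF M]])
next
  case False
  then show ?thesis using f_0[of x y] subspace_0[OF W_subspace] by (auto simp: psiL_0)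
qed

text \<open>Downward induction on s, starting beyond level a + c where the span is zero; on
  generators of level s, \<open>psiL_f\<close> applies.\<close>

lemma psiL_W: "v \<in> W s \<Longrightarrow> psiL v \<in> W s"
proof (induction "Suc (a + c) - s" arbitrary: s v)
  case 0
  then have "v \<in> W (Suc (a + c))" using W_mono[of "Suc (a + c)" s] by auto
  then show ?case using W_top[of v] subspace_0[OF W_subspace, of s] by (simp add: psiL_0)
next
  case (Suc l)
  have IH: "psiL v \<in> W (Suc s)" if "v \<in> W (Suc s)" for v
    by (rule Suc.hyps(1)) (use Suc.hyps(2) that in auto)
  have sub: "W (Suc s) \<subseteq> W s" by (rule W_mono) simp
  from Suc.prems show ?case
    unfolding W_def[of s]
  proof (induction rule: span_induct)
    case base
    show ?case
      using W_subspace[of s] unfolding W_def[symmetric]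
      by (auto simp: subspace_def psiL_0 psiL_add psiL_sc)
  next
    case (step v)
    then obtain x y where v: "v = f x y" and xy: "s \<le> x + y" by auto
    have "psiL (f x y) \<in> W s"
    proof (cases "s = x + y")
      case True
      then have "psiL (f x y) - f x y \<in> W s"
        using psiL_f[of x y] IH sub by auto
      then have "(psiL (f x y) - f x y) + f x y \<in> W s"
        by (rule subspace_add[OF W_subspace]) (rule f_in_W[OF xy])
      then show ?thesis by simp
    next
      case False
      then have "f x y \<in> W (Suc s)" using xy by (intro f_in_W) simp
      then show ?thesis using IH sub by auto
    qed
    then show ?case by (simp add: v W_def)
  qed
qed

text \<open>Treat the levels in increasing order. Once lower coefficients vanish, modulo the next
  level \<open>psiL\<close> only bars the coefficients of level s; independence makes them bar
  invariant, hence zero.\<close>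

lemma invariant_combination_0:
  assumes e: "\<And>x y. e x y \<in> qinv_int_polys"
    and inv: "psiL (\<Sum>(x, y)\<in>{..a} \<times> {..c}. sc (e x y) (f x y)) = (\<Sum>(x, y)\<in>{..a} \<times> {..c}. sc (e x y) (f x y))"
  shows "x \<le> a \<Longrightarrow> y \<le> c \<Longrightarrow> e x y = 0"
proof (induction "x + y" arbitrary: x y rule: less_induct)
  case (less x y)
  define s where "s = x + y"
  define J where "J = {(x, y). x \<le> a \<and> y \<le> c \<and> x + y = s}"
  define J' where "J' = {..a} \<times> {..c} - J"
  have J: "J \<subseteq> {..a} \<times> {..c}" by (auto simp: J_def)
  have "psiL (f x y) - f x y \<in> W (Suc s)" if "(x, y) \<in> J" for x y
    using psiL_f[of x y] psiL_W that by (simp add: J_def)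
  then have low: "(\<Sum>(x, y)\<in>J. sc (bar (e x y)) (psiL (f x y) - f x y)) \<in> W (Suc s)"
    by (intro subspace_sum[OF W_subspace]) (auto intro: subspace_scale[OF W_subspace])
  define rest where "rest = (\<Sum>(x, y)\<in>J'. sc (e x y) (f x y))"
  have rest: "rest \<in> W (Suc s)"
    unfolding rest_def
  proof (rule subspace_sum[OF W_subspace])
    fix p assume p: "p \<in> J'"
    obtain x' y' where pe: "p = (x', y')" by (cases p)
    show "(case p of (x, y) \<Rightarrow> sc (e x y) (f x y)) \<in> W (Suc s)"
    proof (cases "x' + y' < s")
      case True
      then have "e x' y' = 0" using less.hyps[of x' y'] p pe by (auto simp: s_def J'_def)
      then show ?thesis using subspace_0[OF W_subspace] by (simp add: pe scal_0)
    next
      case False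
      then have "Suc s \<le> x' + y'" using p by (auto simp: pe J'_def J_def)
      then show ?thesis by (simp add: pe subspace_scale[OF W_subspace f_in_W])
    qed
  qed
  have split: "(\<Sum>(x, y)\<in>{..a} \<times> {..c}. sc (e x y) (f x y)) = (\<Sum>(x, y)\<in>J. sc (e x y) (f x y)) + rest"
    unfolding rest_def J'_def using J by (simp add: sum.subset_diff[of J] add.commute)
  have "(\<Sum>(x, y)\<in>J. sc (bar (e x y)) (psiL (f x y))) + psiL rest = (\<Sum>(x, y)\<in>J. sc (e x y) (f x y)) + rest"
    using inv unfolding split by (simp add: psiL_add psiL_sum psiL_sc case_prod_unfold)
  then have "(\<Sum>(x, y)\<in>J. sc (bar (e x y) - e x y) (f x y)) =
      (rest - psiL rest) - (\<Sum>(x, y)\<in>J. sc (bar (e x y)) (psiL (f x y) - f x y))"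
    by (simp add: case_prod_unfold scale_left_diff_distrib scale_right_diff_distrib sum_subtractf algebra_simps)
  also have "\<dots> \<in> W (Suc s)"
    by (intro subspace_diff[OF W_subspace] rest psiL_W low)
  finally have "bar (e x y) - e x y = 0"
    unfolding J_def by (intro level_independent[of s]) (use less.prems in \<open>auto simp: s_def\<close>)
  then show ?case using qinv_int_polys_bar_invariant[OF e] by simp
qed

text \<open>Moves the sum to one fixed index box so that two elements can be subtracted termwise:
  coefficients are zero off S, and monomials are zero off the box.\<close>

lemma icb_coset_form:
  assumes "v \<in> icb_coset act \<eta> (int a) (int b) (int c)"
  obtains e where "\<And>x y. e x y \<in> qinv_int_polys"
    and "v = f 0 0 + (\<Sum>(x, y)\<in>{..a} \<times> {..c}. sc (e x y) (f x y))"
proof -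
  from assms obtain S d where S: "finite S" and d: "\<And>x y. d x y \<in> qinv_int_polys"
    and v: "v = f 0 0 + (\<Sum>(x, y)\<in>S. sc (d x y) (f x y))"
    by (auto simp: icb_coset_def f_def)
  define e where "e x y = (if (x, y) \<in> S then d x y else 0)" for x y
  have "(\<Sum>(x, y)\<in>S. sc (d x y) (f x y)) = (\<Sum>(x, y)\<in>S \<inter> {..a} \<times> {..c}. sc (d x y) (f x y))"
  proof (rule sum.mono_neutral_right)
    show "\<forall>p\<in>S - S \<inter> {..a} \<times> {..c}. (case p of (x, y) \<Rightarrow> sc (d x y) (f x y)) = 0"
    proof
      fix p assume p: "p \<in> S - S \<inter> {..a} \<times> {..c}"
      obtain x y where xy: "p = (x, y)" by (cases p)
      then show "(case p of (x, y) \<Rightarrow> sc (d x y) (f x y)) = 0"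
        using p f_0[of x y] by (auto simp: not_le)
    qed
  qed (use S in auto)
  also have "\<dots> = (\<Sum>(x, y)\<in>S \<inter> {..a} \<times> {..c}. sc (e x y) (f x y))"
    by (rule sum.cong) (auto simp: e_def)
  also have "\<dots> = (\<Sum>(x, y)\<in>{..a} \<times> {..c}. sc (e x y) (f x y))"
    by (rule sum.mono_neutral_left) (auto simp: e_def scal_0 split: if_splits)
  finally show ?thesis using that[of e] d v by (simp add: e_def)
qed

lemma icb_unique:
  assumes "v \<in> icb_coset act \<eta> (int a) (int b) (int c)" "psiL v = v"
    and "w \<in> icb_coset act \<eta> (int a) (int b) (int c)" "psiL w = w"
  shows "v = w"
proof -
  obtain e where e: "\<And>x y. e x y \<in> qinv_int_polys"
    and v: "v = f 0 0 + (\<Sum>(x, y)\<in>{..a} \<times> {..c}. sc (e x y) (f x y))"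
    using icb_coset_form[OF assms(1)] by blast
  obtain e' where e': "\<And>x y. e' x y \<in> qinv_int_polys"
    and w: "w = f 0 0 + (\<Sum>(x, y)\<in>{..a} \<times> {..c}. sc (e' x y) (f x y))"
    using icb_coset_form[OF assms(3)] by blast
  have vw: "v - w = (\<Sum>(x, y)\<in>{..a} \<times> {..c}. sc (e x y - e' x y) (f x y))"
    by (simp add: v w scale_left_diff_distrib sum_subtractf case_prod_unfold)
  have "e x y - e' x y = 0" if "x \<le> a" "y \<le> c" for x y
    by (rule invariant_combination_0[OF _ _ that])
      (use e e' assms(2,4) in \<open>auto simp: vw[symmetric] psiL_diff qinv_int_polys_diff\<close>)
  then have "v - w = 0" unfolding vw by (intro sum.neutral) (auto simp: scal_0)
  then show ?thesis by simp
qed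

lemma icb_eqI:
  assumes "v \<in> icb_coset act \<eta> (int a) (int b) (int c)" "psiL v = v"
  shows "icb act \<eta> psiL (int a) (int b) (int c) = v"
  unfolding icb_def using assms icb_unique by (intro the_equality) auto

end

section \<open>The vectors \<open>V k\<close> and their identification with the icanonical
  basis\<close>

locale expansion_setting = hw_module act m n \<eta>
  for act :: "Uq \<Rightarrow> 'v \<Rightarrow> 'v::ab_group_add" and m n :: nat and \<eta> :: 'v +
  fixes a b c :: nat and \<sigma> :: "idx \<Rightarrow> int" and psi :: "Uq \<Rightarrow> Uq" and psiL :: "'v \<Rightarrow> 'v"
    and \<beta> :: int and d :: nat
  assumes ibar: "is_ibar \<sigma> psi" and ibarL: "is_ibar_module \<sigma> psi act \<eta> psiL"
    and acb: "a + c < b" and cm: "c \<le> m" and bnc: "b \<le> n + c"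
    and \<sigma>_sum: "\<sigma> I1 + \<sigma> I2 = 1"
    and \<beta>: "\<beta> = int n - int m + int a - 2 * int b + 3 * int c + \<sigma> I1"
    and \<beta>_pos: "\<beta> > 0"
    and d: "int d = int n + int c - int b - \<beta> + 1"
begin

definition rcoef :: "nat \<Rightarrow> Qq" where
  "rcoef y = q powi (int y * (\<sigma> I2 - int n - int c + int b) - int (tri y)) * gb (int m - int c) y"

definition G :: "nat \<Rightarrow> 'v" where
  "G z = (\<Sum>y\<le>b. sc (q powi (- (int z * int y)) * rcoef y)
     (Fm (int a - int z) (int b - int z - int y) (int c - int y)))"

definition V :: "nat \<Rightarrow> 'v" where
  "V k = (\<Sum>x\<le>a - k. sc (scoef d (\<beta> + int k) x) (G (k + x)))"

abbreviation M :: "nat \<Rightarrow> 'v" where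
  "M k \<equiv> Bmon \<sigma> act \<eta> (int a - int k) (int b - int k) (int c)"

lemma level_module:
  assumes "k \<le> a"
  shows "icb_module act m n \<eta> (a - k) (b - k) c \<sigma> psi psiL"
  by unfold_locales (use assms acb cm bnc ibar ibarL in auto)

lemma rcoef_0 [simp]: "rcoef 0 = 1"
  by (simp add: rcoef_def)

text \<open>Normalising the binomial costs q^((m - c)y). The remaining exponent is y(1 - \<beta> + a
  + c - b) minus a triangular number, negative because \<beta> > 0 and b > a + c.\<close>

lemma rcoef_qinv_int_polys:
  assumes "y > 0"
  shows "rcoef y \<in> qinv_int_polys"
proof -
  define e where "e = int y * (\<sigma> I2 - int n - int c + int b + (int m - int c)) - int (tri y)"
  have "\<sigma> I2 - int n - int c + int b + (int m - int c) = 1 - \<beta> + int a + int c - int b"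
    using \<beta> \<sigma>_sum by simp
  also have "\<dots> < 0" using \<beta>_pos acb by simp
  finally have "int y * (\<sigma> I2 - int n - int c + int b + (int m - int c)) < 0"
    using assms by (simp add: mult_pos_neg)
  then have "e < 0" by (simp add: e_def)
  have "rcoef y = q powi e * (q powi (- (int (m - c) * int y)) * gb (int (m - c)) y)"
    unfolding rcoef_def e_def mult.assoc[symmetric] q_powi_add[symmetric]
    using cm by (simp add: of_nat_diff algebra_simps)
  then show ?thesis
    using \<open>e < 0\<close> gb_nat_qinv_polys by (simp add: qinv_int_polys_mult qinv_int_polys_powi)
qed

text \<open>As a and b drop together, the exponent parameter 1 - d is unchanged and the binomial
  parameter becomes \<beta> + k + d - 1. The y-part changes by q^(-ky), which
  \<open>G (k + x)\<close> absorbs.\<close>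

lemma M_eq:
  assumes k: "k \<le> a"
  shows "M k = (\<Sum>x\<le>a - k. sc (pcoef d (\<beta> + int k) x) (G (k + x)))"
proof -
  have i: "int a - int k = int (a - k)" "int b - int k = int (b - k)"
    using k acb by simp_all
  have coeff: "q powi (- (int x * int y))
      * (q powi (int x * (\<sigma> I1 - int m + 2 * int c - int (b - k) + int (a - k)) - int (tri x)) * gb (int n + int c - int (b - k)) x)
      * (q powi (int y * (\<sigma> I2 - int n - int c + int (b - k)) - int (tri y)) * gb (int m - int c) y)
    = pcoef d (\<beta> + int k) x * (q powi (- (int (k + x) * int y)) * rcoef y)" for x y
  proof -
    have N: "int n + int c - int (b - k) = \<beta> + int k + int d - 1" using d by (simp add: i(2)[symmetric])
    have L: "\<sigma> I1 - int m + 2 * int c - int (b - k) + int (a - k) = 1 - int d"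
      using d \<beta> by (simp add: i[symmetric])
    have Y: "q powi (- (int x * int y)) * q powi (int y * (\<sigma> I2 - int n - int c + int (b - k)) - int (tri y)) =
        q powi (- (int (k + x) * int y)) * q powi (int y * (\<sigma> I2 - int n - int c + int b) - int (tri y))"
      unfolding q_powi_add[symmetric] i(2)[symmetric]
      by (rule arg_cong[where f = "\<lambda>e. q powi e"]) (simp add: algebra_simps)
    have rearrange: "u * p * (v * g) = p * (u * v * g)" for u p v g :: Qq
      by simp
    show ?thesis
      unfolding N L pcoef_def rcoef_def rearrange Y by (simp only: mult_ac)
  qed
  have "M k = (\<Sum>x\<le>a - k. \<Sum>y\<le>b - k. sc (pcoef d (\<beta> + int k) x * (q powi (- (int (k + x) * int y)) * rcoef y))
      (Fm (int (a - k) - int x) (int (b - k) - int x - int y) (int c - int y)))"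
    unfolding i Bmon_expansion coeff ..
  also have "\<dots> = (\<Sum>x\<le>a - k. sc (pcoef d (\<beta> + int k) x) (G (k + x)))"
  proof (rule sum.cong[OF HOL.refl])
    fix x
    have e: "int (a - k) - int x = int a - int (k + x)" "int (b - k) - int x = int b - int (k + x)"
      by (simp_all add: i[symmetric])
    have "(\<Sum>y\<le>b - k. sc (pcoef d (\<beta> + int k) x * (q powi (- (int (k + x) * int y)) * rcoef y))
        (Fm (int (a - k) - int x) (int (b - k) - int x - int y) (int c - int y))) =
      (\<Sum>y\<le>b. sc (pcoef d (\<beta> + int k) x * (q powi (- (int (k + x) * int y)) * rcoef y))
        (Fm (int a - int (k + x)) (int b - int (k + x) - int y) (int c - int y)))"
      unfolding e
    \<comment> \<open>For y > b - k the exponent of F_2 is negative, so y may run to b, a range free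
      of k.\<close>
    proof (rule sum.mono_neutral_left)
      show "\<forall>y\<in>{..b} - {..b - k}. sc (pcoef d (\<beta> + int k) x * (q powi (- (int (k + x) * int y)) * rcoef y))
          (Fm (int a - int (k + x)) (int b - int (k + x) - int y) (int c - int y)) = 0"
      proof
        fix y assume "y \<in> {..b} - {..b - k}"
        then have "int b - int (k + x) - int y < 0" by auto
        then show "sc (pcoef d (\<beta> + int k) x * (q powi (- (int (k + x) * int y)) * rcoef y))
            (Fm (int a - int (k + x)) (int b - int (k + x) - int y) (int c - int y)) = 0"
          using Fm_neg by simp
      qed
    qed auto
    then show "(\<Sum>y\<le>b - k. sc (pcoef d (\<beta> + int k) x * (q powi (- (int (k + x) * int y)) * rcoef y))
        (Fm (int (a - k) - int x) (int (b - k) - int x - int y) (int c - int y))) =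
      sc (pcoef d (\<beta> + int k) x) (G (k + x))"
      by (simp add: G_def scale_sum_right)
  qed
  finally show ?thesis .
qed

lemma M_eq_V:
  assumes "k \<le> a"
  shows "M k = (\<Sum>j\<le>a - k. sc (acoef (\<beta> + int k) j) (V (k + j)))"
proof -
  have "(\<Sum>j\<le>a - k. sc (acoef (\<beta> + int k) j) (V (k + j))) =
      (\<Sum>j\<le>a - k. sc (acoef (\<beta> + int k) j) (\<Sum>x\<le>a - k - j. sc (scoef d (\<beta> + int k + int j) x) (G (k + (j + x)))))"
    by (simp add: V_def add.assoc)
  also have "\<dots> = (\<Sum>z\<le>a - k. sc (\<Sum>j\<le>z. acoef (\<beta> + int k) j * scoef d (\<beta> + int k + int j) (z - j)) (G (k + z)))"
    by (rule triangle_sum[where g = "\<lambda>z. G (k + z)"])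
  also have "\<dots> = (\<Sum>z\<le>a - k. sc (pcoef d (\<beta> + int k) z) (G (k + z)))"
    using pcoef_expansion[of "\<beta> + int k" d] \<beta>_pos by simp
  finally show ?thesis using M_eq[OF assms] by simp
qed

lemma V_0_eq_M:
  assumes "even \<beta>"
  shows "V 0 = (\<Sum>k\<le>a. sc (bcoef \<beta> k) (M k))"
proof -
  have "(\<Sum>k\<le>a. sc (bcoef \<beta> k) (M k)) =
      (\<Sum>k\<le>a. sc (bcoef \<beta> k) (\<Sum>x\<le>a - k. sc (pcoef d (\<beta> + int k) x) (G (k + x))))"
    by (rule sum.cong) (simp_all add: M_eq)
  also have "\<dots> = (\<Sum>z\<le>a. sc (\<Sum>k\<le>z. bcoef \<beta> k * pcoef d (\<beta> + int k) (z - k)) (G z))"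
    by (rule triangle_sum)
  also have "\<dots> = V 0"
    using scoef_eq_pcoef_sum[OF \<beta>_pos assms, of d] by (simp add: V_def)
  finally show ?thesis by simp
qed

text \<open>Solve \<open>M_eq_V\<close> for its j = 0 term, which has coefficient 1. The B-monomial
  and the coefficients are invariant, and the other vectors are so by induction.\<close>

lemma V_invariant: "k \<le> a \<Longrightarrow> psiL (V k) = V k"
proof (induction "a - k" arbitrary: k rule: less_induct)
  case (less k)
  interpret icb_module act m n \<eta> "a - k" "b - k" c \<sigma> psi psiL
    using less.prems by (rule level_module)
  have "{..a - k} = insert 0 {1..a - k}" by auto
  then have M: "M k = V k + (\<Sum>j\<in>{1..a - k}. sc (acoef (\<beta> + int k) j) (V (k + j)))"
    by (simp add: M_eq_V[OF less.prems])
  have "psiL (V (k + j)) = V (k + j)" if "j \<in> {1..a - k}" for j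
    using that by (intro less.hyps) auto
  then have "psiL (\<Sum>j\<in>{1..a - k}. sc (acoef (\<beta> + int k) j) (V (k + j))) =
      (\<Sum>j\<in>{1..a - k}. sc (acoef (\<beta> + int k) j) (V (k + j)))"
    by (simp add: psiL_sum psiL_sc)
  moreover have "V k = M k - (\<Sum>j\<in>{1..a - k}. sc (acoef (\<beta> + int k) j) (V (k + j)))"
    using M by simp
  ultimately show ?case by (simp only: psiL_diff psiL_Bmon)
qed

lemma V_coset:
  assumes "k \<le> a"
  shows "V k \<in> icb_coset act \<eta> (int a - int k) (int b - int k) (int c)"
proof -
  define e where "e x y = (if x = 0 \<and> y = 0 then 0
    else scoef d (\<beta> + int k) x * (q powi (- (int (k + x) * int y)) * rcoef y))" for x y
  have mem: "e x y \<in> qinv_int_polys" for x y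
  proof -
    have p: "q powi (- (int (k + x) * int y)) \<in> qinv_polys"
      by (rule qinv_polys_powi) simp
    have r: "rcoef y \<in> qinv_polys"
      using rcoef_qinv_int_polys[of y] by (cases "y = 0") (auto intro: qinv_int_polys_subset)
    \<comment> \<open>Away from the origin at least one factor lies in q^-1 Z[q^-1]:
      \<open>scoef\<close> if x > 0, and \<open>rcoef\<close> if x = 0 < y.\<close>
    consider "x > 0" | "x = 0" "y > 0" | "x = 0" "y = 0" by blast
    then show ?thesis
    proof cases
      case 1
      then show ?thesis
        using scoef_qinv_int_polys[of "\<beta> + int k" x d] \<beta>_pos p r
        by (simp add: e_def qinv_int_polys_mult qinv_polys_mult)
    next
      case 2
      have "rcoef y * q powi (- (int (k + x) * int y)) \<in> qinv_int_polys"
        using rcoef_qinv_int_polys 2 p by (simp add: qinv_int_polys_mult)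
      then show ?thesis using 2 by (simp add: e_def mult.commute)
    next
      case 3
      then show ?thesis by (simp add: e_def)
    qed
  qed
  define S where "S = {..a - k} \<times> {..b} - {(0, 0)}"
  have "V k = (\<Sum>(x, y)\<in>{..a - k} \<times> {..b}. sc (scoef d (\<beta> + int k) x * (q powi (- (int (k + x) * int y)) * rcoef y))
      (Fm (int a - int k - int x) (int b - int k - int x - int y) (int c - int y)))"
    by (simp add: V_def G_def scale_sum_right sum.cartesian_product algebra_simps)
  also have "\<dots> = Fm (int a - int k) (int b - int k) (int c)
      + (\<Sum>(x, y)\<in>S. sc (scoef d (\<beta> + int k) x * (q powi (- (int (k + x) * int y)) * rcoef y))
          (Fm (int a - int k - int x) (int b - int k - int x - int y) (int c - int y)))"
    unfolding S_def by (subst sum.remove[of _ "(0, 0)"]) simp_all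
  also have "(\<Sum>(x, y)\<in>S. sc (scoef d (\<beta> + int k) x * (q powi (- (int (k + x) * int y)) * rcoef y))
          (Fm (int a - int k - int x) (int b - int k - int x - int y) (int c - int y))) =
      (\<Sum>(x, y)\<in>S. sc (e x y) (Fm (int a - int k - int x) (int b - int k - int x - int y) (int c - int y)))"
    by (rule sum.cong) (auto simp: S_def e_def simp del: of_nat_add split: if_splits)
  finally have V: "V k = Fm (int a - int k) (int b - int k) (int c)
      + (\<Sum>(x, y)\<in>S. sc (e x y) (Fm (int a - int k - int x) (int b - int k - int x - int y) (int c - int y)))" .
  have "finite S" "(0, 0) \<notin> S" by (simp_all add: S_def)
  then show ?thesis
    unfolding icb_coset_def using mem V by blast
qed

lemma icb_eq_V:
  assumes "k \<le> a"
  shows "icb act \<eta> psiL (int a - int k) (int b - int k) (int c) = V k"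
proof -
  interpret icb_module act m n \<eta> "a - k" "b - k" c \<sigma> psi psiL
    using assms by (rule level_module)
  have i: "int (a - k) = int a - int k" "int (b - k) = int b - int k"
    using assms acb by simp_all
  show ?thesis
    using icb_eqI[of "V k"] V_coset[OF assms] V_invariant[OF assms] unfolding i by simp
qed

end

section \<open>The two expansion formulas\<close>

theorem theorem5p12:
  fixes \<sigma> :: "idx \<Rightarrow> int"
    and act :: "Uq \<Rightarrow> 'v \<Rightarrow> 'v::ab_group_add"
    and \<eta> :: 'v
    and psi :: "Uq \<Rightarrow> Uq"
    and psiL :: "'v \<Rightarrow> 'v"
    and m n a b c :: nat
    and \<beta> :: int
  assumes "(\<sigma> I1, \<sigma> I2) \<in> {(1, 0), (0, 1)}"
    and "is_L act m n \<eta>"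
    and "is_ibar \<sigma> psi"
    and "is_ibar_module \<sigma> psi act \<eta> psiL"
    and "m \<ge> c"
    and "int n - int b + int c \<ge> 0"
    and "\<beta> = int n - int m + int a - 2 * int b + 3 * int c + \<sigma> I1"
    and "\<beta> > 0"
    and "even \<beta>"
    and "b > a + c"
  shows "Bmon \<sigma> act \<eta> (int a) (int b) (int c) =
           (\<Sum>k | k \<le> a \<and> even k.
              act (scal (even_coeff \<beta> k)) (icb act \<eta> psiL (int a - int k) (int b - int k) (int c)))
         + (\<Sum>k | k \<le> a \<and> odd k.
              act (scal (odd_coeff \<beta> k)) (icb act \<eta> psiL (int a - int k) (int b - int k) (int c)))
       \<and> icb act \<eta> psiL (int a) (int b) (int c) =
           (\<Sum>k = 0..a.
              act (scal ((- 1) ^ k * (qprod \<beta> k / qfact k)))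
                (Bmon \<sigma> act \<eta> (int a - int k) (int b - int k) (int c)))"
proof -
  \<comment> \<open>Substituting \<beta> gives (m - c) + (b - a - c) + 1 - \<sigma>_1, which is
    nonnegative, so \<open>nat\<close> loses nothing.\<close>
  define d where "d = nat (int n + int c - int b - \<beta> + 1)"
  have \<sigma>: "\<sigma> I1 + \<sigma> I2 = 1" "\<sigma> I1 \<le> 1" using assms(1) by auto
  have d: "int d = int n + int c - int b - \<beta> + 1"
    unfolding d_def using assms(5,7,10) \<sigma>(2) by simp
  interpret expansion_setting act m n \<eta> a b c \<sigma> psi psiL \<beta> d
    by unfold_locales (use assms \<sigma> d in \<open>auto simp: is_L_def is_simple_module_def\<close>)
  have icb: "icb act \<eta> psiL (int a - int k) (int b - int k) (int c) = V k" if "k \<le> a" for k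
    using that by (rule icb_eq_V)
  have "Bmon \<sigma> act \<eta> (int a) (int b) (int c) = (\<Sum>k\<le>a. sc (acoef \<beta> k) (V k))"
    using M_eq_V[of 0] by simp
  also have "\<dots> = (\<Sum>k\<in>{k. k \<le> a \<and> even k} \<union> {k. k \<le> a \<and> odd k}. sc (acoef \<beta> k) (V k))"
    by (rule sum.cong) auto
  also have "\<dots> = (\<Sum>k | k \<le> a \<and> even k. sc (acoef \<beta> k) (V k)) + (\<Sum>k | k \<le> a \<and> odd k. sc (acoef \<beta> k) (V k))"
    by (rule sum.union_disjoint) auto
  also have "(\<Sum>k | k \<le> a \<and> even k. sc (acoef \<beta> k) (V k)) =
      (\<Sum>k | k \<le> a \<and> even k. sc (even_coeff \<beta> k) (icb act \<eta> psiL (int a - int k) (int b - int k) (int c)))"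
    \<comment> \<open>As \<beta> is even, the parity test in \<open>acoef\<close> is that of
      k.\<close>
    by (rule sum.cong) (use assms(9) in \<open>auto simp: icb acoef_def\<close>)
  also have "(\<Sum>k | k \<le> a \<and> odd k. sc (acoef \<beta> k) (V k)) =
      (\<Sum>k | k \<le> a \<and> odd k. sc (odd_coeff \<beta> k) (icb act \<eta> psiL (int a - int k) (int b - int k) (int c)))"
    by (rule sum.cong) (use assms(9) in \<open>auto simp: icb acoef_def\<close>)
  finally show ?thesis
    using V_0_eq_M[OF assms(9)] icb[of 0] by (simp add: bcoef_def atLeast0AtMost)
qed

end
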